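(* Let $\Theta=(\theta_1,\theta_2,\theta_3,\theta_4)\in\mathbb{R}^4$ be such that $1,\theta_1,\theta_2,\theta_3,\theta_4$ are linearly independent over $\mathbb{Z}$, and write $\omega=\omega(\Theta)$, $\hat\omega=\hat\omega(\Theta)$, and assume $\hat\omega<1$. Then: 1) if $\mathfrak{i}(\Theta)=1$, then $\omega\ge \hat\omega\, G_1(\hat\omega)$; 2) if $\mathfrak{i}(\Theta)=2$, then $\omega\ge \hat\omega\, G_2(\hat\omega)$; 3) if $\mathfrak{i}(\Theta)=3$, then $\omega\ge \hat\omega\, G_3(\hat\omega)$.
   Context: For $x\in\mathbb{R}$, $\|x\|$ is the distance to the nearest integer. Let $\psi_\Theta(t)=\min_{q\in\mathbb{Z}_+,\,q\le t}\max_{1\le j\le4}\|q\theta_j\|$. Define $\omega(\Theta)=\sup\{\gamma:\liminf_{t\to\infty}t^\gamma\psi_\Theta(t)<\infty\}$ and $\hat\omega(\Theta)=\sup\{\gamma:\limsup_{t\to\infty}t^\gamma\psi_\Theta(t)<\infty\}$; one has $1/4\le\hat\omega\le1$. Best approximations: a positive integer $q$ is a best approximation denominator if $\max_j\|x\theta_j\|>\max_j\|q\theta_j\|$ for all integers $1\le x<q$; enumerate them $q_0<q_1<\cdots$, let $a_{j,\nu}$ be the integer nearest to $q_\nu\theta_j$, and $\mathbf{z}_\nu=(q_\nu,a_{1,\nu},\dots,a_{4,\nu})\in\mathbb{Z}^5$. Index: $\mathfrak{i}(\Theta)$ is the least positive integer $n$ for which there exists a sequence (indexed by $l=1,2,\dots$)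 of index tuples $\nu_l=r_0<r_1<\dots<r_n<r_{n+1}=k_l$ (the $r_i$ depending on $l$) such that: (i) $\nu_l\to\infty$; (ii) for each $0\le i\le n+1$, $\mathbf{z}_{r_i-1},\mathbf{z}_{r_i},\mathbf{z}_{r_i+1}$ are linearly independent; (iii) for each $0\le i\le n$, all consecutive pairs $(\mathbf{z}_{m},\mathbf{z}_{m+1})$ with $r_i\le m\le r_{i+1}-1$ span the same two-dimensional subspace of $\mathbb{R}^5$; (iv) there is a three-dimensional subspace $T_l$ with $T_l=\mathrm{span}(\mathbf{z}_{r_i-1},\mathbf{z}_{r_i},\mathbf{z}_{r_i+1})$ for all $1\le i\le n$; (v) $\mathbf{z}_{\nu_l-1}\notin T_l$ and $\mathbf{z}_{k_l+1}\notin T_l$; (vi) $\mathbf{z}_{\nu_l-1},\mathbf{z}_{r_n-1},\mathbf{z}_{k_l-1},\mathbf{z}_{k_l},\mathbf{z}_{k_l+1}$ are linearly independent. If no such $n$ exists, $\mathfrak{i}(\Theta)=\infty$. Functions: for $w\in[1/4,1)$ put $c=\frac{w}{1-w}$. $G_1(w)$ is the unique positive real root of $x^3-cx^2-cx-c$. For $w\in[1/4,1/2]$, $G_2(w)$ is the unique positive root of $x^4-cx^3-cx^2+c^2x-\frac{w}{(1-w)^2}$; for $w\in[1/2,1)$, $G_2(w)$ is the unique positive root of $x^4-cx^3-cx^2+cx-\frac{w}{(1-w)^2}$. $G_3(w)$ is the unique positive root of $x^5-cx^4-cx^3+c^2x^2-\frac{w}{(1-w)^2}$.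
   Formalization: The polynomial defining G_3(w) has three positive roots for w near 1 (e.g. w = 9/10), so "the unique positive root" is ill-defined there; G_3(w) is taken to be the largest positive root, which agrees with the unique root whenever it is unique. *)

theory Defs
  imports "HOL-Analysis.Analysis"
begin

definition nint_dist :: "real \<Rightarrow> real" where
  "nint_dist x = \<bar>x - of_int (round x)\<bar>"

definition approx_err :: "real^4 \<Rightarrow> nat \<Rightarrow> real" where
  "approx_err \<Theta> q = (MAX j. nint_dist (real q * \<Theta> $ j))"

definition lin_indep_over_Z :: "real^4 \<Rightarrow> bool" where
  "lin_indep_over_Z \<Theta> \<longleftrightarrow>
     (\<forall>(b::int) (a::4 \<Rightarrow> int).
        of_int b + (\<Sum>j\<in>UNIV. of_int (a j) * \<Theta> $ j) = 0 \<longrightarrow> b = 0 \<and> (\<forall>j. a j = 0))"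

text \<open>The minimum is meaningful for \<open>t \<ge> 1\<close> only; only the behaviour as \<open>t\<close> tends to infinity
  is used below.\<close>

definition psi :: "real^4 \<Rightarrow> real \<Rightarrow> real" where
  "psi \<Theta> t = (MIN q\<in>{q::nat. 0 < q \<and> real q \<le> t}. approx_err \<Theta> q)"

text \<open>The ordinary exponent may be infinite, hence the extended reals.\<close>

definition omega :: "real^4 \<Rightarrow> ereal" where
  "omega \<Theta> = Sup (ereal ` {\<gamma>. Liminf at_top (\<lambda>t::real. ereal (t powr \<gamma> * psi \<Theta> t)) < \<infinity>})"

definition omega_hat :: "real^4 \<Rightarrow> ereal" where
  "omega_hat \<Theta> = Sup (ereal ` {\<gamma>. Limsup at_top (\<lambda>t::real. ereal (t powr \<gamma> * psi \<Theta> t)) < \<infinity>})"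

definition best_approx_denoms :: "real^4 \<Rightarrow> nat set" where
  "best_approx_denoms \<Theta> =
     {q. 0 < q \<and> (\<forall>x. 1 \<le> x \<and> x < q \<longrightarrow> approx_err \<Theta> x > approx_err \<Theta> q)}"

text \<open>The set of denominators is infinite as soon as some coordinate of \<open>\<Theta>\<close> is irrational.\<close>

definition best_q :: "real^4 \<Rightarrow> nat \<Rightarrow> nat" where
  "best_q \<Theta> \<nu> = enumerate (best_approx_denoms \<Theta>) \<nu>"

text \<open>The five-dimensional space is represented as \<open>real \<times> (real^4)\<close>, the first factor holding the
  denominator.\<close>

definition best_z :: "real^4 \<Rightarrow> nat \<Rightarrow> real \<times> (real^4)" where
  "best_z \<Theta> \<nu> =
     (real (best_q \<Theta> \<nu>), \<chi> j. of_int (round (real (best_q \<Theta> \<nu>) * \<Theta> $ j)))"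

definition lin_indep_tuple :: "'a::real_vector list \<Rightarrow> bool" where
  "lin_indep_tuple vs \<longleftrightarrow> distinct vs \<and> independent (set vs)"

text \<open>A tuple of indices \<open>r 0 < r 1 < \<dots> < r (n + 1)\<close>; the first and the last entry play the roles
  of \<open>\<nu>\<^sub>l\<close> and \<open>k\<^sub>l\<close>. The condition \<open>1 \<le> r 0\<close> makes the index \<open>r 0 - 1\<close> exist.\<close>

definition admissible_tuple :: "real^4 \<Rightarrow> nat \<Rightarrow> (nat \<Rightarrow> nat) \<Rightarrow> bool" where
  "admissible_tuple \<Theta> n r \<longleftrightarrow>
     (let z = best_z \<Theta>; \<nu> = r 0; k = r (n + 1) in
       1 \<le> \<nu> \<and> (\<forall>i\<le>n. r i < r (i + 1)) \<and>
       (\<forall>i\<le>n+1. lin_indep_tuple [z (r i - 1), z (r i), z (r i + 1)]) \<and>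
       (\<forall>i\<le>n. \<exists>S. subspace S \<and> dim S = 2 \<and>
          (\<forall>m. r i \<le> m \<and> m \<le> r (i + 1) - 1 \<longrightarrow> span {z m, z (m + 1)} = S)) \<and>
       (\<exists>T. subspace T \<and> dim T = 3 \<and>
          (\<forall>i. 1 \<le> i \<and> i \<le> n \<longrightarrow> T = span {z (r i - 1), z (r i), z (r i + 1)}) \<and>
          z (\<nu> - 1) \<notin> T \<and> z (k + 1) \<notin> T) \<and>
       lin_indep_tuple [z (\<nu> - 1), z (r n - 1), z (k - 1), z k, z (k + 1)])"

definition approx_index :: "real^4 \<Rightarrow> enat" where
  "approx_index \<Theta> = Inf (enat ` {n. 1 \<le> n \<and>
     (\<exists>r::nat \<Rightarrow> nat \<Rightarrow> nat. filterlim (\<lambda>l. r l 0) at_top sequentially \<and>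
        (\<forall>l. admissible_tuple \<Theta> n (r l)))})"

definition G1 :: "real \<Rightarrow> real" where
  "G1 w = (let c = w / (1 - w) in THE x. 0 < x \<and> x^3 - c * x^2 - c * x - c = 0)"

definition G2 :: "real \<Rightarrow> real" where
  "G2 w = (let c = w / (1 - w) in
     if w \<le> 1/2
     then THE x. 0 < x \<and> x^4 - c * x^3 - c * x^2 + c^2 * x - w / (1 - w)^2 = 0
     else THE x. 0 < x \<and> x^4 - c * x^3 - c * x^2 + c * x - w / (1 - w)^2 = 0)"

text \<open>The polynomial equals \<open>x\<^sup>2 (x\<^sup>2 - c) (x - c) - c (c + 1)\<close>. For \<open>w\<close> near 1 it has three positive
  roots (for \<open>w = 9/10\<close> they lie in \<open>(1, 2)\<close>, \<open>(2, 3)\<close> and \<open>(9, 10)\<close>), so a definite description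
  would be unspecified there. Taking the largest positive root agrees with the unique positive
  root whenever there is one and makes a lower bound in terms of \<open>G3\<close> strongest otherwise.\<close>

definition G3_roots :: "real \<Rightarrow> real set" where
  "G3_roots w = (let c = w / (1 - w) in
     {x. 0 < x \<and> x^5 - c * x^4 - c * x^3 + c^2 * x^2 - w / (1 - w)^2 = 0})"

definition G3 :: "real \<Rightarrow> real" where
  "G3 w = Max (G3_roots w)"

lemma G3_eq_the_root:
  assumes "\<exists>!x. x \<in> G3_roots w"
  shows "G3 w = (THE x. x \<in> G3_roots w)"
proof -
  from assms obtain r where r: "G3_roots w = {r}" by auto
  show ?thesis by (simp add: G3_def r)
qed

end

theory Submission
  imports Defs
begin

text \<open>Write \<open>X\<^sub>m\<close>, \<open>L\<^sub>m\<close> for the denominator and the error of the \<open>m\<close>-th best approximation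
  \<open>z\<^sub>m\<close>. For an admissible tuple of any length \<open>n \<ge> 1\<close> let \<open>\<nu>\<close>, \<open>s\<close> and \<open>k\<close> be its first, second
  and last entry. The vectors with indices \<open>\<nu> - 1, s - 1, s, s + 1, k + 1\<close> are linearly
  independent, so their determinant is at least \<open>1\<close> in absolute value. Since \<open>z\<^sub>\<nu>\<close> and \<open>z\<^sub>k\<close> lie in
  the span of the middle three, subtracting suitable multiples of \<open>z\<^sub>s\<^sub>+\<^sub>1\<close>, \<open>z\<^sub>\<nu>\<close>, \<open>z\<^sub>k\<close> makes all
  denominators but one vanish, which gives
  \<open>1 \<lless> X\<^sub>s\<^sub>+\<^sub>1 L\<^sub>s L\<^sub>s\<^sub>-\<^sub>1 L\<^sub>\<nu>\<^sub>-\<^sub>1 X\<^sub>k\<^sub>+\<^sub>1 L\<^sub>k / X\<^sub>k\<close>.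
  Moreover \<open>X\<^sub>s L\<^sub>s\<^sub>-\<^sub>1 \<lless> X\<^sub>\<nu>\<^sub>+\<^sub>1 L\<^sub>\<nu>\<close>, because both sides are comparable to the covolume of the
  same planar lattice. If \<open>L\<^sub>m \<lless> X\<^sub>m\<^sub>+\<^sub>1\<^sup>-\<^sup>w\<close> and \<open>X\<^sub>m\<^sub>+\<^sub>1 \<lless> X\<^sub>m\<^sup>G\<close> for all large \<open>m\<close>, these
  estimates become linear inequalities between logarithms. With \<open>g = G\<^sub>1(w)\<close>, that is
  \<open>(1 - w) g\<^sup>3 = w (g\<^sup>2 + g + 1)\<close>, convex combinations of them eliminate the indices \<open>\<nu>\<close> and \<open>s\<close>
  and bound \<open>(1 - w) (g - G) log X\<^sub>k\<close>, so \<open>G \<ge> g\<close>. Hence \<open>\<omega> \<ge> w G\<^sub>1(w)\<close> for all \<open>w\<close> below the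
  uniform exponent, whatever the index is, and \<open>G\<^sub>2\<close> and \<open>G\<^sub>3\<close> are at most \<open>G\<^sub>1\<close> on \<open>[1/4, 1)\<close>.\<close>

section \<open>The functions \<open>G1\<close>, \<open>G2\<close>, \<open>G3\<close>\<close>

definition growth_ratio :: "real \<Rightarrow> real" where
  "growth_ratio x = x^3 / (x^2 + x + 1)"

lemma growth_ratio_denominator_pos:
  fixes x :: real
  assumes "0 \<le> x"
  shows "0 < x^2 + x + 1"
  using assms by (simp add: add_nonneg_pos)

lemma growth_ratio_strict_mono:
  assumes "0 \<le> x" "x < y"
  shows "growth_ratio x < growth_ratio y"
proof -
  have "y^3 * (x^2 + x + 1) - x^3 * (y^2 + y + 1)
      = (y - x) * (x^2 * y^2 + x * y * (x + y) + (x^2 + x * y + y^2))"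
    by algebra
  moreover have "0 < (y - x) * (x^2 * y^2 + x * y * (x + y) + (x^2 + x * y + y^2))"
    using assms by (intro mult_pos_pos add_nonneg_pos) auto
  ultimately have "x^3 * (y^2 + y + 1) < y^3 * (x^2 + x + 1)"
    by linarith
  then show ?thesis
    using growth_ratio_denominator_pos assms
    by (simp add: growth_ratio_def frac_less_eq divide_simps)
qed

lemma growth_ratio_le_iff:
  assumes "0 \<le> x" "0 \<le> y"
  shows "growth_ratio x \<le> growth_ratio y \<longleftrightarrow> x \<le> y"
  using assms growth_ratio_strict_mono[of x y] growth_ratio_strict_mono[of y x]
  by (cases x y rule: linorder_cases) auto

lemma growth_ratio_less_iff:
  assumes "0 \<le> x" "0 \<le> y"
  shows "growth_ratio x < growth_ratio y \<longleftrightarrow> x < y"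
  using growth_ratio_le_iff[OF assms(2,1)] by linarith

lemma continuous_on_growth_ratio: "continuous_on {0..} growth_ratio"
  unfolding growth_ratio_def
  using growth_ratio_denominator_pos by (intro continuous_intros) force

lemma
  assumes "0 \<le> x"
  shows le_growth_ratio_iff: "a \<le> growth_ratio x \<longleftrightarrow> a \<le> x^3 - a * x^2 - a * x"
    and less_growth_ratio_iff: "a < growth_ratio x \<longleftrightarrow> a < x^3 - a * x^2 - a * x"
    and growth_ratio_eq_iff: "growth_ratio x = a \<longleftrightarrow> x^3 - a * x^2 - a * x - a = 0"
  using growth_ratio_denominator_pos[OF assms]
  by (simp_all add: growth_ratio_def pos_le_divide_eq pos_less_divide_eq divide_eq_eq algebra_simps)

lemma ex_growth_ratio_eq:
  assumes "0 < c"
  obtains x where "0 < x" "growth_ratio x = c"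
proof -
  have "(c + 1)^3 - c * (c + 1)^2 - c * (c + 1) = c + 1"
    by algebra
  then have "c \<le> growth_ratio (c + 1)"
    using assms by (simp add: le_growth_ratio_iff)
  moreover have "growth_ratio 0 = 0"
    by (simp add: growth_ratio_def)
  moreover have "continuous_on {0..c + 1} growth_ratio"
    by (rule continuous_on_subset[OF continuous_on_growth_ratio]) simp
  ultimately obtain x where x: "0 \<le> x" "growth_ratio x = c"
    using IVT'[of growth_ratio 0 c "c + 1"] assms by auto
  moreover from this have "x \<noteq> 0"
    using assms by (auto simp: growth_ratio_def)
  ultimately show ?thesis
    using that[of x] by simp
qed

lemma
  assumes "0 < w" "w < 1"
  shows G1_pos: "0 < G1 w" and growth_ratio_G1: "growth_ratio (G1 w) = w / (1 - w)"
proof -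
  define c where "c = w / (1 - w)"
  obtain x where x: "0 < x" "growth_ratio x = c"
    using ex_growth_ratio_eq[of c] assms by (auto simp: c_def)
  have root_iff: "y^3 - c * y^2 - c * y - c = 0 \<longleftrightarrow> y = x" if "0 < y" for y
  proof -
    have "y^3 - c * y^2 - c * y - c = 0 \<longleftrightarrow> growth_ratio y = growth_ratio x"
      using growth_ratio_eq_iff[of y c] that x(2) by simp
    also have "\<dots> \<longleftrightarrow> y = x"
      using x(1) that by (simp add: order_eq_iff growth_ratio_le_iff)
    finally show ?thesis .
  qed
  have "G1 w = x"
    unfolding G1_def Let_def c_def[symmetric]
  proof (rule the_equality)
    show "0 < x \<and> x^3 - c * x^2 - c * x - c = 0"
      using root_iff[of x] x(1) by blast
  qed (use root_iff in blast)
  then show "0 < G1 w" "growth_ratio (G1 w) = w / (1 - w)"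
    using x by (simp_all add: c_def)
qed

lemma G1_cubic_eq:
  assumes "0 < w" "w < 1"
  shows "(1 - w) * (G1 w)^3 = w * ((G1 w)^2 + G1 w + 1)"
  using growth_ratio_G1[OF assms] growth_ratio_denominator_pos[of "G1 w"] G1_pos[OF assms] assms
  by (simp add: growth_ratio_def field_simps)

lemma G1_ge_1:
  assumes "1/4 \<le> w" "w < 1"
  shows "1 \<le> G1 w"
proof -
  have "growth_ratio 1 \<le> w / (1 - w)"
    using assms by (simp add: growth_ratio_def field_simps)
  also have "\<dots> = growth_ratio (G1 w)"
    using growth_ratio_G1 assms by simp
  finally show ?thesis
    using growth_ratio_le_iff[of 1 "G1 w"] G1_pos[of w] assms by simp
qed

lemma divide_less_G1:
  assumes "0 < w" "w < 1"
  shows "w / (1 - w) < G1 w"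
proof -
  have "growth_ratio (G1 w) < G1 w"
    using G1_pos[OF assms] by (simp add: growth_ratio_def divide_less_eq
        growth_ratio_denominator_pos power3_eq_cube power2_eq_square algebra_simps add_pos_pos)
  then show ?thesis
    by (simp add: growth_ratio_G1[OF assms])
qed

lemma
  assumes "0 < w" "w < 1" "0 \<le> x"
  defines "c \<equiv> w / (1 - w)"
  shows G1_le_iff: "G1 w \<le> x \<longleftrightarrow> c \<le> x^3 - c * x^2 - c * x"
    and G1_less_iff: "G1 w < x \<longleftrightarrow> c < x^3 - c * x^2 - c * x"
  using growth_ratio_le_iff[of "G1 w" x] growth_ratio_less_iff[of "G1 w" x]
    G1_pos[OF assms(1,2)] growth_ratio_G1[OF assms(1,2)] assms(3)
  by (simp_all add: c_def le_growth_ratio_iff less_growth_ratio_iff)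

lemma mult_G1_le_if_all_less:
  assumes "0 < W" "W < 1" and le: "\<And>w. 0 < w \<Longrightarrow> w < W \<Longrightarrow> w * G1 w \<le> b"
  shows "W * G1 W \<le> b"
proof -
  have "0 < (W / 2) * G1 (W / 2)"
    using assms(1,2) by (intro mult_pos_pos G1_pos) simp_all
  also have "\<dots> \<le> b"
    using assms(1) by (intro le) simp_all
  finally have b: "0 < b" .
  have ratio_le: "w / (1 - w) \<le> growth_ratio (b / w)" if "0 < w" "w < W" for w
  proof -
    have "growth_ratio (G1 w) \<le> growth_ratio (b / w)"
      using le[OF that] that b assms(2) G1_pos[of w]
      by (simp add: growth_ratio_le_iff pos_le_divide_eq mult.commute)
    then show ?thesis
      using growth_ratio_G1[of w] that assms(2) by simp
  qed
  have "isCont growth_ratio (b / W)"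
    by (rule continuous_on_interior[OF continuous_on_growth_ratio]) (use b assms(1) in simp)
  moreover have "((\<lambda>w. b / w) \<longlongrightarrow> b / W) (at_left W)"
    using assms(1) by (intro tendsto_intros) simp
  ultimately have "((\<lambda>w. growth_ratio (b / w)) \<longlongrightarrow> growth_ratio (b / W)) (at_left W)"
    by (rule isCont_tendsto_compose)
  moreover have "((\<lambda>w. w / (1 - w)) \<longlongrightarrow> W / (1 - W)) (at_left W)"
    using assms(2) by (intro tendsto_intros) simp
  moreover have "\<forall>\<^sub>F w in at_left W. w / (1 - w) \<le> growth_ratio (b / w)"
    using eventually_at_left_real[OF assms(1)] by eventually_elim (simp add: ratio_le)
  ultimately have "W / (1 - W) \<le> growth_ratio (b / W)"
    by (intro tendsto_le[of "at_left W"]) simp_all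
  then have "growth_ratio (G1 W) \<le> growth_ratio (b / W)"
    using growth_ratio_G1 assms(1,2) by simp
  then show ?thesis
    using G1_pos[of W] b assms(1,2)
    by (simp add: growth_ratio_le_iff pos_le_divide_eq mult.commute)
qed

lemma ex_positive_root:
  fixes f :: "real \<Rightarrow> real"
  assumes "continuous_on {0..g} f" "0 \<le> g" "f 0 < 0" "0 \<le> f g"
  obtains x where "0 < x" "x \<le> g" "f x = 0"
proof -
  obtain x where "0 \<le> x" "x \<le> g" "f x = 0"
    using IVT'[of f 0 0 g] assms by auto
  moreover from this have "x \<noteq> 0"
    using assms(3) by auto
  ultimately show ?thesis
    using that[of x] by simp
qed

text \<open>Divided by \<open>x\<^sup>3\<close>, the polynomial is strictly increasing.\<close>

lemma quartic_positive_root_unique: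
  fixes c d x y :: real
  defines "f \<equiv> \<lambda>x. x^4 - c * x^3 - c * x^2 + c * d * x - c * (c + 1)"
  assumes "0 < c" "d^2 \<le> 3 * (c + 1)" "0 < x" "0 < y" "f x = 0" "f y = 0"
  shows "x = y"
proof -
  have less: "y^3 * f x < x^3 * f y" if "0 < x" "x < y" for x y
  proof -
    define s t where "s = x + y" and "t = x * y"
    have "t^2 - d * t * s + (c + 1) * (s^2 - t)
        = (t - d * s / 2)^2 + (3 * (c + 1) - d^2) * s^2 / 4 + (c + 1) * (x - y)^2 / 4"
      unfolding s_def t_def by (simp add: field_simps power2_eq_square)
    also have "\<dots> \<ge> 0"
      using assms by (intro add_nonneg_nonneg) auto
    finally have "0 < (y - x) * (t^3 + c * (t^2 - d * t * s + (c + 1) * (s^2 - t)))"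
      using that assms by (intro mult_pos_pos add_pos_nonneg mult_nonneg_nonneg) (auto simp: t_def)
    also have "\<dots> = x^3 * f y - y^3 * f x"
      unfolding f_def s_def t_def by algebra
    finally show ?thesis by simp
  qed
  show ?thesis
    using less[of x y] less[of y x] assms by (cases x y rule: linorder_cases) auto
qed

lemma G2_eq:
  assumes "0 < w" "w < 1"
  defines "c \<equiv> w / (1 - w)"
  shows "G2 w = (THE x. 0 < x \<and> x^4 - c * x^3 - c * x^2 + c * min c 1 * x - c * (c + 1) = 0)"
proof -
  have "w / (1 - w)^2 = c * (c + 1)"
    using assms by (simp add: c_def field_simps power2_eq_square)
  moreover have "w \<le> 1/2 \<longleftrightarrow> c \<le> 1"
    using assms by (simp add: c_def field_simps)
  ultimately show ?thesis
    by (simp add: G2_def Let_def min_def power2_eq_square flip: c_def)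
qed

lemma G1_quartic_nonneg:
  assumes "1/4 \<le> w" "w < 1"
  defines "c \<equiv> w / (1 - w)" and "g \<equiv> G1 w"
  shows "0 \<le> g^4 - c * g^3 - c * g^2 + c * min c 1 * g - c * (c + 1)"
proof -
  have c: "0 < c"
    using assms by (simp add: c_def)
  have g: "1 \<le> g" "c < g"
    using G1_ge_1[OF assms(1,2)] divide_less_G1[of w] assms(1,2) by (simp_all add: g_def c_def)
  have "c + 1 \<le> max c 1 * (1 + min c 1)"
    by (simp add: max_def min_def algebra_simps)
  also have "\<dots> \<le> g * (1 + min c 1)"
    using g c by (intro mult_right_mono) auto
  finally have "c * (c + 1) \<le> c * (g * (1 + min c 1))"
    using c by (intro mult_left_mono) auto
  also have "\<dots> = g * (c + c * min c 1)"
    by algebra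
  also have "\<dots> \<le> g * (g^3 - c * g^2 - c * g + c * min c 1)"
    using G1_le_iff[of w g, folded c_def g_def] g assms(1,2) by (intro mult_left_mono) simp_all
  also have "\<dots> = g^4 - c * g^3 - c * g^2 + c * min c 1 * g"
    by algebra
  finally show ?thesis
    by simp
qed

lemma G2_le_G1:
  assumes "1/4 \<le> w" "w < 1"
  shows "G2 w \<le> G1 w"
proof -
  define c where "c = w / (1 - w)"
  let ?f = "\<lambda>x::real. x^4 - c * x^3 - c * x^2 + c * min c 1 * x - c * (c + 1)"
  have c: "0 < c"
    using assms by (simp add: c_def)
  have "continuous_on {0..G1 w} ?f"
    by (intro continuous_intros)
  moreover have "0 \<le> G1 w"
    using G1_ge_1[OF assms] by simp
  moreover have "?f 0 < 0"
    using c by simp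
  ultimately obtain x where x: "0 < x" "x \<le> G1 w" "?f x = 0"
    using G1_quartic_nonneg[OF assms, folded c_def] by (rule ex_positive_root)
  have "(min c 1)^2 \<le> 1"
    using c by (intro power_le_one) auto
  also have "1 \<le> 3 * (c + 1)"
    using c by simp
  finally have unique: "y = x" if "0 < y" "?f y = 0" for y
    using quartic_positive_root_unique[of c "min c 1" y x] that x c by blast
  have "G2 w = (THE x. 0 < x \<and> ?f x = 0)"
    using G2_eq[of w] assms by (simp add: c_def)
  also have "\<dots> = x"
    using x unique by (intro the_equality) blast+
  finally show ?thesis
    using x by simp
qed

lemma G3_roots_eq:
  assumes "0 < w" "w < 1"
  defines "c \<equiv> w / (1 - w)"
  shows "G3_roots w = {x. 0 < x \<and> x^2 * (x^3 - c * x^2 - c * x + c^2) = c * (c + 1)}"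
proof -
  have "w / (1 - w)^2 = c * (c + 1)"
    using assms by (simp add: c_def field_simps power2_eq_square)
  moreover have "x^2 * (x^3 - c * x^2 - c * x + c^2) = x^5 - c * x^4 - c * x^3 + c^2 * x^2" for x
    by algebra
  ultimately show ?thesis
    by (simp add: G3_roots_def Let_def flip: c_def)
qed

lemma finite_G3_roots: "finite (G3_roots w)"
proof (rule finite_subset)
  define c where "c = w / (1 - w)"
  let ?p = "[:- (w / (1 - w)^2), 0, c^2, - c, - c, 1:]"
  show "G3_roots w \<subseteq> {x. poly ?p x = 0}"
    by (auto simp: G3_roots_def Let_def eval_nat_numeral algebra_simps simp flip: c_def)
  show "finite {x. poly ?p x = 0}"
    by (rule poly_roots_finite) simp
qed

lemma G3_le_G1:
  assumes "1/4 \<le> w" "w < 1"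
  shows "G3 w \<le> G1 w"
proof -
  define c where "c = w / (1 - w)"
  let ?f = "\<lambda>x::real. x^2 * (x^3 - c * x^2 - c * x + c^2)"
  have c: "0 < c"
    using assms by (simp add: c_def)
  note g = G1_ge_1[OF assms]
  have roots: "G3_roots w = {x. 0 < x \<and> ?f x = c * (c + 1)}"
    using G3_roots_eq[of w] assms by (simp add: c_def)
  have "1 * (c * (c + 1)) \<le> ?f (G1 w)"
  proof (rule mult_mono)
    show "c * (c + 1) \<le> (G1 w)^3 - c * (G1 w)^2 - c * G1 w + c^2"
      using G1_le_iff[of w "G1 w"] g assms by (simp add: power2_eq_square distrib_left flip: c_def)
  qed (use g c in auto)
  moreover have "continuous_on {0..G1 w} (\<lambda>x. ?f x - c * (c + 1))"
    by (intro continuous_intros)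
  ultimately obtain x where "0 < x" "?f x - c * (c + 1) = 0"
    using ex_positive_root[of "G1 w" "\<lambda>x. ?f x - c * (c + 1)"] c g by auto
  then have "G3_roots w \<noteq> {}"
    unfolding roots by force
  moreover have "x \<le> G1 w" if "x \<in> G3_roots w" for x
  proof (rule ccontr)
    assume "\<not> x \<le> G1 w"
    then have x: "G1 w < x"
      by simp
    then have "c * (c + 1) < x^3 - c * x^2 - c * x + c^2"
      using G1_less_iff[of w x] g assms by (simp add: power2_eq_square distrib_left flip: c_def)
    moreover have "1 < x^2"
      using x g by (simp add: one_less_power)
    ultimately have "1 * (c * (c + 1)) < ?f x"
      using c by (intro mult_strict_mono) auto
    then show False
      using that by (simp add: roots)
  qed
  ultimately show ?thesis
    unfolding G3_def using finite_G3_roots by simp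
qed

section \<open>Best approximations\<close>

definition err_vec :: "real^'n \<Rightarrow> real \<times> (real^'n) \<Rightarrow> real^'n" where
  "err_vec \<Theta> v = snd v - fst v *\<^sub>R \<Theta>"

definition integral_vec :: "real \<times> (real^'n) \<Rightarrow> bool" where
  "integral_vec v \<longleftrightarrow> fst v \<in> \<int> \<and> (\<forall>j. snd v $ j \<in> \<int>)"

lemma err_vec_add: "err_vec \<Theta> (u + v) = err_vec \<Theta> u + err_vec \<Theta> v"
  and err_vec_diff: "err_vec \<Theta> (u - v) = err_vec \<Theta> u - err_vec \<Theta> v"
  and err_vec_minus: "err_vec \<Theta> (- u) = - err_vec \<Theta> u"
  and err_vec_scaleR: "err_vec \<Theta> (a *\<^sub>R u) = a *\<^sub>R err_vec \<Theta> u"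
  by (simp_all add: err_vec_def algebra_simps)

lemma integral_vec_diff: "integral_vec u \<Longrightarrow> integral_vec v \<Longrightarrow> integral_vec (u - v)"
  and integral_vec_minus: "integral_vec u \<Longrightarrow> integral_vec (- u)"
  and integral_vec_scaleR: "integral_vec u \<Longrightarrow> a \<in> \<int> \<Longrightarrow> integral_vec (a *\<^sub>R u)"
  by (simp_all add: integral_vec_def)

lemma infnorm_le_iff_cart: "infnorm (v :: real^'n) \<le> b \<longleftrightarrow> (\<forall>j. \<bar>v $ j\<bar> \<le> b)"
proof
  show "infnorm v \<le> b \<Longrightarrow> \<forall>j. \<bar>v $ j\<bar> \<le> b"
    using component_le_infnorm_cart order_trans by blast
  show "\<forall>j. \<bar>v $ j\<bar> \<le> b \<Longrightarrow> infnorm v \<le> b"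
    unfolding infnorm_cart by (rule cSup_least) auto
qed

lemma integral_vec_eq_0:
  assumes "integral_vec v" "fst v = 0" "infnorm (err_vec \<Theta> v) < 1"
  shows "v = 0"
proof -
  have "snd v $ j = 0" for j
  proof -
    have "\<bar>snd v $ j\<bar> < 1"
      using component_le_infnorm_cart[of "err_vec \<Theta> v" j] assms by (simp add: err_vec_def)
    then show ?thesis
      using assms(1) Ints_nonzero_abs_less1 unfolding integral_vec_def by blast
  qed
  then show ?thesis
    using assms(2) by (simp add: prod_eq_iff vec_eq_iff)
qed

lemma nint_dist_le: "nint_dist x \<le> \<bar>x - of_int n\<bar>"
  unfolding nint_dist_def using round_diff_minimal[of x n] by simp

lemma approx_err_le_iff: "approx_err \<Theta> q \<le> b \<longleftrightarrow> (\<forall>j. nint_dist (real q * \<Theta> $ j) \<le> b)"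
  unfolding approx_err_def by (subst Max_le_iff) auto

lemma nint_dist_le_approx_err: "nint_dist (real q * \<Theta> $ j) \<le> approx_err \<Theta> q"
  using approx_err_le_iff by blast

lemma approx_err_nonneg: "0 \<le> approx_err \<Theta> q"
  using nint_dist_le_approx_err[of q \<Theta> 1] by (simp add: nint_dist_def)

lemma approx_err_le_half: "approx_err \<Theta> q \<le> 1/2"
  unfolding approx_err_le_iff nint_dist_def
  using of_int_round_abs_le by (metis abs_minus_commute)

lemma approx_err_le_infnorm:
  assumes "integral_vec v" "fst v = real q"
  shows "approx_err \<Theta> q \<le> infnorm (err_vec \<Theta> v)"
  unfolding approx_err_le_iff
proof
  fix j
  obtain n where n: "snd v $ j = of_int n"
    using assms(1) unfolding integral_vec_def Ints_def by blast
  have "nint_dist (real q * \<Theta> $ j) \<le> \<bar>real q * \<Theta> $ j - of_int n\<bar>"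
    by (rule nint_dist_le)
  also have "\<dots> = \<bar>err_vec \<Theta> v $ j\<bar>"
    using assms(2) n by (simp add: err_vec_def abs_minus_commute)
  also have "\<dots> \<le> infnorm (err_vec \<Theta> v)"
    by (rule component_le_infnorm_cart)
  finally show "nint_dist (real q * \<Theta> $ j) \<le> infnorm (err_vec \<Theta> v)" .
qed

lemma integral_vec_best_z: "integral_vec (best_z \<Theta> m)"
  by (simp add: integral_vec_def best_z_def)

lemma fst_best_z: "fst (best_z \<Theta> m) = real (best_q \<Theta> m)"
  by (simp add: best_z_def)

lemma infnorm_err_vec_best_z: "infnorm (err_vec \<Theta> (best_z \<Theta> m)) = approx_err \<Theta> (best_q \<Theta> m)"
proof (rule antisym)
  show "approx_err \<Theta> (best_q \<Theta> m) \<le> infnorm (err_vec \<Theta> (best_z \<Theta> m))"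
    by (rule approx_err_le_infnorm) (simp_all add: integral_vec_best_z fst_best_z)
  show "infnorm (err_vec \<Theta> (best_z \<Theta> m)) \<le> approx_err \<Theta> (best_q \<Theta> m)"
    unfolding infnorm_le_iff_cart
    using nint_dist_le_approx_err[of "best_q \<Theta> m" \<Theta>]
    by (simp add: err_vec_def best_z_def nint_dist_def abs_minus_commute)
qed

lemma Dirichlet_approx_err:
  assumes "0 < N"
  obtains q where "0 < q" "q \<le> N^4" "approx_err \<Theta> q \<le> 1 / real N"
proof -
  obtain h :: "nat \<Rightarrow> 4" where h: "bij_betw h {0..<4} UNIV"
    using ex_bij_betw_nat_finite[of "UNIV :: 4 set"] by auto
  obtain q p where q: "0 < q" "q \<le> int (N^4)"
    and p: "\<And>i. i < 4 \<Longrightarrow> \<bar>of_int q * \<Theta> $ h i - of_int (p i)\<bar> < 1 / real N"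
    using Dirichlet_approx_simult[OF assms, of 4 "\<lambda>i. \<Theta> $ h i"] by metis
  have "nint_dist (real (nat q) * \<Theta> $ j) \<le> 1 / real N" for j
  proof -
    obtain i where "i < 4" "h i = j"
      using h unfolding bij_betw_def by (metis atLeastLessThan_iff imageE UNIV_I)
    then have "\<bar>real (nat q) * \<Theta> $ j - of_int (p i)\<bar> \<le> 1 / real N"
      using p[of i] q(1) by simp
    with nint_dist_le show ?thesis
      by (rule order_trans)
  qed
  then show ?thesis
    using that[of "nat q"] q by (simp add: approx_err_le_iff nat_le_iff)
qed

lemma approx_err_pos:
  assumes "lin_indep_over_Z \<Theta>" "0 < q"
  shows "0 < approx_err \<Theta> q"
proof (rule ccontr)
  assume "\<not> ?thesis"
  then have "nint_dist (real q * \<Theta> $ 1) \<le> 0"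
    using nint_dist_le_approx_err[of q \<Theta> 1] by linarith
  then have integer: "real q * \<Theta> $ 1 = of_int (round (real q * \<Theta> $ 1))"
    by (simp add: nint_dist_def)
  define a :: "4 \<Rightarrow> int" where "a = (\<lambda>j. if j = 1 then int q else 0)"
  have "(\<Sum>j\<in>UNIV. of_int (a j) * \<Theta> $ j) = (\<Sum>j\<in>(UNIV::4 set). if j = 1 then real q * \<Theta> $ 1 else 0)"
    unfolding a_def by (intro sum.cong) auto
  then have "of_int (- round (real q * \<Theta> $ 1)) + (\<Sum>j\<in>UNIV. of_int (a j) * \<Theta> $ j) = 0"
    using integer by simp
  then have "a 1 = 0"
    using assms(1) unfolding lin_indep_over_Z_def by blast
  then show False
    using assms(2) by (simp add: a_def)
qed

lemma ex_best_approx_denom_le: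
  assumes "0 < q"
  obtains p where "p \<in> best_approx_denoms \<Theta>" "p \<le> q" "approx_err \<Theta> p \<le> approx_err \<Theta> q"
proof -
  define P where "P p \<longleftrightarrow> 0 < p \<and> approx_err \<Theta> p \<le> approx_err \<Theta> q" for p
  define p where "p = (LEAST p. P p)"
  have "P q"
    using assms by (simp add: P_def)
  then have p: "P p" "p \<le> q" and least: "\<And>x. x < p \<Longrightarrow> \<not> P x"
    unfolding p_def by (auto intro: LeastI Least_le dest: not_less_Least)
  have "approx_err \<Theta> p < approx_err \<Theta> x" if "1 \<le> x" "x < p" for x
    using p(1) least[OF that(2)] that(1) by (auto simp: P_def)
  then have "p \<in> best_approx_denoms \<Theta>"
    using p(1) by (auto simp: best_approx_denoms_def P_def)
  then show ?thesis
    using that p by (auto simp: P_def)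
qed

lemma infinite_best_approx_denoms:
  assumes "lin_indep_over_Z \<Theta>"
  shows "infinite (best_approx_denoms \<Theta>)"
proof
  let ?B = "best_approx_denoms \<Theta>"
  assume "finite ?B"
  moreover have "?B \<noteq> {}"
    using ex_best_approx_denom_le[of 1 \<Theta>] by auto
  moreover have "0 < approx_err \<Theta> p" if "p \<in> ?B" for p
    using that approx_err_pos[OF assms] by (simp add: best_approx_denoms_def)
  ultimately have "0 < Min (approx_err \<Theta> ` ?B)"
    by simp
  then obtain N where N: "0 < N" "1 / real N < Min (approx_err \<Theta> ` ?B)"
    using reals_Archimedean by (metis inverse_eq_divide zero_less_Suc)
  obtain q where q: "0 < q" "approx_err \<Theta> q \<le> 1 / real N"
    using Dirichlet_approx_err[OF N(1)] by metis
  obtain p where p: "p \<in> ?B" "approx_err \<Theta> p \<le> approx_err \<Theta> q"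
    using ex_best_approx_denom_le[OF q(1)] by metis
  have "Min (approx_err \<Theta> ` ?B) \<le> approx_err \<Theta> p"
    using \<open>finite ?B\<close> p(1) by simp
  then show False
    using N(2) p(2) q(2) by linarith
qed

locale independent_point =
  fixes \<Theta> :: "real^4"
  assumes indep: "lin_indep_over_Z \<Theta>"
begin

abbreviation X :: "nat \<Rightarrow> nat" where "X \<equiv> best_q \<Theta>"
abbreviation L :: "nat \<Rightarrow> real" where "L m \<equiv> approx_err \<Theta> (X m)"
abbreviation z :: "nat \<Rightarrow> real \<times> (real^4)" where "z \<equiv> best_z \<Theta>"

lemma X_mem: "X m \<in> best_approx_denoms \<Theta>"
  unfolding best_q_def using enumerate_in_set infinite_best_approx_denoms[OF indep] by blast

lemma X_pos: "0 < X m"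
  using X_mem by (auto simp: best_approx_denoms_def)

lemma X_less: "m < n \<Longrightarrow> X m < X n"
  unfolding best_q_def using enumerate_mono infinite_best_approx_denoms[OF indep] by blast

lemma X_le: "m \<le> n \<Longrightarrow> X m \<le> X n"
  using X_less[of m n] by (cases "m = n") auto

lemma X_ge: "m \<le> X m"
  unfolding best_q_def using le_enumerate infinite_best_approx_denoms[OF indep] by blast

lemma L_pos: "0 < L m"
  using approx_err_pos indep X_pos by blast

lemma L_less: "m < n \<Longrightarrow> L n < L m"
  using X_mem[of n] X_less[of m n] X_pos[of m] by (auto simp: best_approx_denoms_def)

lemma L_le: "m \<le> n \<Longrightarrow> L n \<le> L m"
  using L_less[of m n] by (cases "m = n") auto

lemma L_le_approx_err:
  assumes "0 < q" "q < X (Suc m)"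
  shows "L m \<le> approx_err \<Theta> q"
proof -
  obtain p where p: "p \<in> best_approx_denoms \<Theta>" "p \<le> q" "approx_err \<Theta> p \<le> approx_err \<Theta> q"
    using ex_best_approx_denom_le[OF assms(1)] by metis
  obtain i where i: "p = X i"
    using enumerate_Ex[OF infinite_best_approx_denoms[OF indep] p(1)] unfolding best_q_def by metis
  have "i \<le> m"
    using X_le[of "Suc m" i] p(2) assms(2) i by linarith
  then show ?thesis
    using L_le[of i m] p(3) i by simp
qed

lemma L_le_infnorm_err_vec:
  assumes "integral_vec v" "fst v \<noteq> 0" "\<bar>fst v\<bar> < real (X (Suc m))"
  shows "L m \<le> infnorm (err_vec \<Theta> v)"
proof -
  have pos: "L m \<le> infnorm (err_vec \<Theta> v)"
    if v: "integral_vec v" "0 < fst v" "fst v < real (X (Suc m))" for v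
  proof -
    obtain n where "fst v = of_int n"
      using v(1) unfolding integral_vec_def Ints_def by blast
    then have q: "fst v = real (nat n)" "0 < nat n"
      using v(2) by auto
    then have "L m \<le> approx_err \<Theta> (nat n)"
      using v(3) by (intro L_le_approx_err) auto
    then show ?thesis
      using approx_err_le_infnorm[OF v(1) q(1)] by (rule order_trans)
  qed
  show ?thesis
  proof (cases "0 < fst v")
    case True
    then show ?thesis using pos[of v] assms by simp
  next
    case False
    then show ?thesis
      using pos[of "- v"] assms by (simp add: integral_vec_minus err_vec_minus infnorm_neg)
  qed
qed

lemma integral_vec_eq_0_if_small:
  assumes "integral_vec v" "\<bar>fst v\<bar> < real (X (Suc m))" "infnorm (err_vec \<Theta> v) < L m"
  shows "v = 0"
proof (rule integral_vec_eq_0)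
  show "fst v = 0"
    using L_le_infnorm_err_vec[of v m] assms by fastforce
  show "infnorm (err_vec \<Theta> v) < 1"
    using assms(3) approx_err_le_half[of \<Theta> "X m"] by linarith
qed (rule assms)

lemma consecutive_small_combination:
  fixes s t :: real and m :: nat
  assumes "\<bar>s\<bar> \<le> 1/2" "\<bar>t\<bar> \<le> 1/2"
  defines "v \<equiv> s *\<^sub>R z m + t *\<^sub>R z (Suc m)"
  shows "\<bar>fst v\<bar> < real (X (Suc m))" "infnorm (err_vec \<Theta> v) < L m"
proof -
  have "\<bar>fst v\<bar> \<le> \<bar>s\<bar> * real (X m) + \<bar>t\<bar> * real (X (Suc m))"
    using abs_triangle_ineq[of "s * real (X m)" "t * real (X (Suc m))"]
    by (simp add: v_def fst_best_z abs_mult)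
  also have "\<dots> \<le> 1/2 * real (X m) + 1/2 * real (X (Suc m))"
    using assms(1,2) by (intro add_mono mult_right_mono) auto
  also have "\<dots> < real (X (Suc m))"
    using X_less[of m "Suc m"] by simp
  finally show "\<bar>fst v\<bar> < real (X (Suc m))" .
  have "infnorm (err_vec \<Theta> v) \<le> \<bar>s\<bar> * L m + \<bar>t\<bar> * L (Suc m)"
    using infnorm_triangle[of "s *\<^sub>R err_vec \<Theta> (z m)" "t *\<^sub>R err_vec \<Theta> (z (Suc m))"]
    by (simp add: v_def err_vec_add err_vec_scaleR infnorm_mul infnorm_err_vec_best_z)
  also have "\<dots> \<le> 1/2 * L m + 1/2 * L (Suc m)"
    using assms(1,2) by (intro add_mono mult_right_mono approx_err_nonneg) auto
  also have "\<dots> < L m"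
    using L_less[of m "Suc m"] by simp
  finally show "infnorm (err_vec \<Theta> v) < L m" .
qed

text \<open>Rounding the coefficients leaves an integral vector that would approximate too well unless it
  vanishes.\<close>

lemma integral_vec_in_span_consecutive:
  assumes "integral_vec u" "u \<in> span {z m, z (Suc m)}"
  obtains a b where "a \<in> \<int>" "b \<in> \<int>" "u = a *\<^sub>R z m + b *\<^sub>R z (Suc m)"
proof -
  obtain s where "u - s *\<^sub>R z m \<in> span {z (Suc m)}"
    using assms(2) unfolding span_breakdown_eq[of u "z m"] by blast
  then obtain t where "u - s *\<^sub>R z m = t *\<^sub>R z (Suc m)"
    unfolding span_singleton by blast
  then have st: "u = s *\<^sub>R z m + t *\<^sub>R z (Suc m)"
    by (simp add: algebra_simps)
  define a b where "a = real_of_int (round s)" and "b = real_of_int (round t)"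
  have ab: "a \<in> \<int>" "b \<in> \<int>"
    by (simp_all add: a_def b_def)
  define v where "v = u - a *\<^sub>R z m - b *\<^sub>R z (Suc m)"
  have v: "v = (s - a) *\<^sub>R z m + (t - b) *\<^sub>R z (Suc m)"
    by (simp add: v_def st algebra_simps)
  have half: "\<bar>s - a\<bar> \<le> 1/2" "\<bar>t - b\<bar> \<le> 1/2"
    unfolding a_def b_def using of_int_round_abs_le by (metis abs_minus_commute)+
  have "integral_vec v"
    unfolding v_def by (intro integral_vec_diff integral_vec_scaleR assms integral_vec_best_z ab)
  then have "v = 0"
    using consecutive_small_combination[OF half] integral_vec_eq_0_if_small unfolding v by blast
  then show ?thesis
    using that[OF ab] by (simp add: v_def algebra_simps)
qed

end

text \<open>In the coordinates given by the denominator and the errors, \<open>wedge \<Theta> u v\<close> consists of the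
  minors of \<open>u, v\<close> that dominate the covolume of the lattice they span.\<close>

definition wedge :: "real^'n \<Rightarrow> real \<times> (real^'n) \<Rightarrow> real \<times> (real^'n) \<Rightarrow> real^'n" where
  "wedge \<Theta> u v = fst u *\<^sub>R err_vec \<Theta> v - fst v *\<^sub>R err_vec \<Theta> u"

lemma wedge_combination:
  "wedge \<Theta> (a *\<^sub>R u + b *\<^sub>R v) (c *\<^sub>R u + d *\<^sub>R v) = (a * d - b * c) *\<^sub>R wedge \<Theta> u v"
  by (simp add: wedge_def err_vec_add err_vec_scaleR algebra_simps)

lemma infnorm_wedge_le:
  "infnorm (wedge \<Theta> u v) \<le> \<bar>fst u\<bar> * infnorm (err_vec \<Theta> v) + \<bar>fst v\<bar> * infnorm (err_vec \<Theta> u)"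
  using infnorm_triangle[of "fst u *\<^sub>R err_vec \<Theta> v" "- (fst v *\<^sub>R err_vec \<Theta> u)"]
  by (simp add: wedge_def infnorm_mul infnorm_neg)

lemma infnorm_wedge_ge:
  "\<bar>fst v\<bar> * infnorm (err_vec \<Theta> u) - \<bar>fst u\<bar> * infnorm (err_vec \<Theta> v) \<le> infnorm (wedge \<Theta> u v)"
  using absdiff_infnorm[of "fst u *\<^sub>R err_vec \<Theta> v" "fst v *\<^sub>R err_vec \<Theta> u"]
  by (simp add: wedge_def infnorm_mul)

context independent_point
begin

lemma infnorm_wedge_consecutive_le:
  "infnorm (wedge \<Theta> (z m) (z (Suc m))) \<le> 2 * (real (X (Suc m)) * L m)"
proof -
  have "real (X m) * L (Suc m) \<le> real (X (Suc m)) * L m"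
    using X_less[of m "Suc m"] L_less[of m "Suc m"]
    by (intro mult_mono) (auto simp: approx_err_nonneg)
  then show ?thesis
    using infnorm_wedge_le[of \<Theta> "z m" "z (Suc m)"]
    by (simp add: fst_best_z infnorm_err_vec_best_z)
qed

lemma infnorm_wedge_best_z_ge:
  assumes "integral_vec u" "fst u \<noteq> 0" "2 * \<bar>fst u\<bar> \<le> real (X (Suc m))"
  shows "real (X (Suc m)) * L m \<le> 2 * infnorm (wedge \<Theta> u (z (Suc m)))"
proof -
  have "L m \<le> infnorm (err_vec \<Theta> u)"
    using assms by (intro L_le_infnorm_err_vec) auto
  then have "real (X (Suc m)) * L m \<le> real (X (Suc m)) * infnorm (err_vec \<Theta> u)"
    by (intro mult_left_mono) auto
  moreover have "2 * \<bar>fst u\<bar> * L (Suc m) \<le> real (X (Suc m)) * L m"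
    using assms(3) L_less[of m "Suc m"] by (intro mult_mono) (auto simp: approx_err_nonneg)
  ultimately show ?thesis
    using infnorm_wedge_ge[of "z (Suc m)" \<Theta> u] by (simp add: fst_best_z infnorm_err_vec_best_z)
qed

text \<open>One of \<open>z m\<close> and \<open>z m - z (Suc m)\<close> has at most half the denominator of \<open>z (Suc m)\<close>.\<close>

lemma infnorm_wedge_consecutive_ge:
  "real (X (Suc m)) * L m \<le> 2 * infnorm (wedge \<Theta> (z m) (z (Suc m)))"
proof (cases "2 * X m \<le> X (Suc m)")
  case True
  then show ?thesis
    using X_pos[of m] by (intro infnorm_wedge_best_z_ge) (auto simp: integral_vec_best_z fst_best_z)
next
  case False
  have "real (X (Suc m)) * L m \<le> 2 * infnorm (wedge \<Theta> (z m - z (Suc m)) (z (Suc m)))"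
    using False X_less[of m "Suc m"]
    by (intro infnorm_wedge_best_z_ge integral_vec_diff integral_vec_best_z) (auto simp: fst_best_z)
  moreover have "wedge \<Theta> (z m - z (Suc m)) (z (Suc m)) = wedge \<Theta> (z m) (z (Suc m))"
    by (simp add: wedge_def err_vec_diff algebra_simps)
  ultimately show ?thesis
    by simp
qed

lemma covolume_le_if_in_span:
  assumes "z n \<in> span {z m, z (Suc m)}" "z (Suc n) \<in> span {z m, z (Suc m)}"
  shows "real (X (Suc m)) * L m \<le> 4 * (real (X (Suc n)) * L n)"
proof -
  obtain a b where ab: "a \<in> \<int>" "b \<in> \<int>" "z n = a *\<^sub>R z m + b *\<^sub>R z (Suc m)"
    using integral_vec_in_span_consecutive[OF integral_vec_best_z assms(1)] by metis
  obtain c d where cd: "c \<in> \<int>" "d \<in> \<int>" "z (Suc n) = c *\<^sub>R z m + d *\<^sub>R z (Suc m)"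
    using integral_vec_in_span_consecutive[OF integral_vec_best_z assms(2)] by metis
  have wedge_eq: "infnorm (wedge \<Theta> (z n) (z (Suc n)))
      = \<bar>a * d - b * c\<bar> * infnorm (wedge \<Theta> (z m) (z (Suc m)))"
    unfolding ab(3) cd(3) wedge_combination by (simp add: infnorm_mul)
  have "0 < real (X (Suc n)) * L n"
    using X_pos L_pos by simp
  then have "a * d - b * c \<noteq> 0"
    using wedge_eq infnorm_wedge_consecutive_ge[of n] by auto
  then have "1 \<le> \<bar>a * d - b * c\<bar>"
    using ab cd by (intro Ints_nonzero_abs_ge1) auto
  then have "1 * infnorm (wedge \<Theta> (z m) (z (Suc m))) \<le> infnorm (wedge \<Theta> (z n) (z (Suc n)))"
    unfolding wedge_eq by (intro mult_right_mono infnorm_pos_le)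
  then show ?thesis
    using infnorm_wedge_consecutive_ge[of m] infnorm_wedge_consecutive_le[of n] by linarith
qed

end

section \<open>Determinants\<close>

lemma det_Ints:
  fixes A :: "real^'n^'n"
  assumes "\<And>i j. A $ i $ j \<in> \<int>"
  shows "det A \<in> \<int>"
  unfolding det_def using assms by (intro Ints_sum Ints_mult Ints_prod) auto

lemma abs_det_le_prod_row_bounds:
  fixes A :: "real^'n^'n"
  assumes "\<And>i j. \<bar>A $ i $ j\<bar> \<le> b i"
  shows "\<bar>det A\<bar> \<le> fact CARD('n) * (\<Prod>i\<in>UNIV. b i)"
proof -
  have "\<bar>of_int (sign p) * (\<Prod>i\<in>UNIV. A $ i $ p i)\<bar> \<le> (\<Prod>i\<in>UNIV. b i)" for p
    using assms by (simp add: abs_mult sign_def abs_prod prod_mono)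
  then have "\<bar>det A\<bar> \<le> of_nat (card {p. p permutes (UNIV :: 'n set)}) * (\<Prod>i\<in>UNIV. b i)"
    unfolding det_def by (intro order_trans[OF sum_abs] sum_bounded_above)
  then show ?thesis
    by (simp add: card_permutations)
qed

lemma det_nonzero_if_span_rows:
  fixes R :: "'n::finite \<Rightarrow> real^'n"
  assumes "span (range R) = UNIV"
  shows "det (\<chi> i. R i) \<noteq> 0"
proof -
  have "rows (\<chi> i. R i) = range R"
    by (auto simp: rows_def row_def vec_lambda_eta)
  then show ?thesis
    using assms matrix_left_invertible_span_rows[of "\<chi> i. R i"]
    by (simp add: invertible_left_inverse flip: invertible_det_nz)
qed

lemma det_add_row_in_span:
  fixes R :: "'n::finite \<Rightarrow> real^'n"
  assumes "v \<in> span (R ` (- {i}))"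
  shows "det (\<chi> k. (R(i := R i + v)) k) = det (\<chi> k. R k)"
proof -
  have "{row j (\<chi> k. R k) |j. j \<noteq> i} = R ` (- {i})"
    by (auto simp: row_def vec_lambda_eta)
  then have "det (\<chi> k. if k = i then row i (\<chi> k. R k) + v else row k (\<chi> k. R k)) = det (\<chi> k. R k)"
    using assms by (intro det_row_span) (simp add: span_vec_eq)
  then show ?thesis
    by (simp add: fun_upd_def row_def vec_lambda_eta if_distrib cong: if_cong)
qed

text \<open>Changing the rows in order of decreasing rank keeps the rows of lower rank available.\<close>

lemma det_diff_lower_rank_rows:
  fixes R P :: "'n::finite \<Rightarrow> real^'n" and rank :: "'n \<Rightarrow> nat"
  assumes lower: "\<And>i. P i \<in> span (R ` {j. rank j < rank i})"
  shows "det (\<chi> i. R i - P i) = det (\<chi> i. R i)"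
proof -
  define S where "S J i = (if i \<in> J then R i - P i else R i)" for J i
  have "det (\<chi> i. S J i) = det (\<chi> i. R i)" if "finite J" for J
    using that
  proof (induction J rule: finite_ranking_induct[where f = "\<lambda>i. - int (rank i)"])
    case empty
    then show ?case by (simp add: S_def)
  next
    case (insert i J)
    show ?case
    proof (cases "i \<in> J")
      case True
      then show ?thesis using insert.IH by (simp add: insert_absorb)
    next
      case False
      have "R ` {j. rank j < rank i} \<subseteq> S J ` (- {i})"
        using insert.hyps by (force simp: S_def)
      then have "- P i \<in> span (S J ` (- {i}))"
        using lower span_mono span_neg by blast
      then have "det (\<chi> k. ((S J)(i := S J i + - P i)) k) = det (\<chi> k. S J k)"
        by (rule det_add_row_in_span)
      moreover have "S (insert i J) = (S J)(i := S J i + - P i)"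
        using False by (auto simp: S_def)
      ultimately show ?thesis using insert.IH by (simp only:)
    qed
  qed
  from this[of UNIV] show ?thesis
    by (simp add: S_def)
qed

definition err_coords :: "real^'n \<Rightarrow> real \<times> (real^'n) \<Rightarrow> real^('n option)" where
  "err_coords \<Theta> v = (\<chi> i. case i of None \<Rightarrow> fst v | Some j \<Rightarrow> err_vec \<Theta> v $ j)"

lemma err_coords_nth [simp]:
  "err_coords \<Theta> v $ None = fst v" "err_coords \<Theta> v $ Some j = err_vec \<Theta> v $ j"
  by (simp_all add: err_coords_def)

lemma linear_err_coords: "linear (err_coords \<Theta>)"
  by (rule linearI)
    (auto simp: vec_eq_iff err_coords_def err_vec_def algebra_simps split: option.split)

lemma surj_err_coords: "surj (err_coords \<Theta>)"
proof (rule surjI)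
  show "err_coords \<Theta> (x $ None, (\<chi> j. x $ Some j) + x $ None *\<^sub>R \<Theta>) = x" for x
    by (auto simp: vec_eq_iff err_coords_def err_vec_def split: option.split)
qed

lemma infnorm_err_coords_le:
  assumes "\<bar>fst v\<bar> \<le> b" "infnorm (err_vec \<Theta> v) \<le> b"
  shows "infnorm (err_coords \<Theta> v) \<le> b"
  unfolding infnorm_le_iff_cart
proof
  show "\<bar>err_coords \<Theta> v $ i\<bar> \<le> b" for i
    using assms by (cases i) (auto simp: infnorm_le_iff_cart)
qed

lemma det_err_coords_eq_det_coords:
  fixes u :: "'n::finite option \<Rightarrow> real \<times> (real^'n)"
  shows "det (\<chi> i. err_coords \<Theta> (u i)) = det (\<chi> i. err_coords 0 (u i))"
proof -
  define C where "C = case_option (\<chi> i. fst (u i)) (\<lambda>j. \<chi> i. snd (u i) $ j)"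
  define P where "P = case_option 0 (\<lambda>j. \<Theta> $ j *\<^sub>R C None)"
  define rank :: "'n option \<Rightarrow> nat" where "rank = case_option 0 (\<lambda>_. 1)"
  have "P k \<in> span (C ` {j. rank j < rank k})" for k
  proof (cases k)
    case None
    then show ?thesis by (simp add: P_def span_zero)
  next
    case (Some j)
    then have "C None \<in> C ` {j. rank j < rank k}"
      by (simp add: rank_def)
    then show ?thesis
      using Some by (simp add: P_def span_base span_scale)
  qed
  then have "det (\<chi> k. C k - P k) = det (\<chi> k. C k)"
    by (rule det_diff_lower_rank_rows)
  moreover have "(\<chi> k. C k - P k) = transpose (\<chi> i. err_coords \<Theta> (u i))"
    and "(\<chi> k. C k) = transpose (\<chi> i. err_coords 0 (u i))"
    by (auto simp: vec_eq_iff transpose_def C_def P_def err_coords_def err_vec_def mult.commute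
        split: option.split)
  ultimately show ?thesis
    by (simp add: det_transpose)
qed

lemma abs_det_err_coords_ge_1:
  fixes u :: "'n::finite option \<Rightarrow> real \<times> (real^'n)"
  assumes "\<And>i. integral_vec (u i)" "span (range u) = UNIV"
  shows "1 \<le> \<bar>det (\<chi> i. err_coords \<Theta> (u i))\<bar>"
proof (rule Ints_nonzero_abs_ge1)
  have "err_coords 0 (u i) $ k \<in> \<int>" for i k
    using assms(1)[of i] by (cases k) (auto simp: integral_vec_def err_vec_def)
  then show "det (\<chi> i. err_coords \<Theta> (u i)) \<in> \<int>"
    by (subst det_err_coords_eq_det_coords) (simp add: det_Ints)
  have "span (range (\<lambda>i. err_coords \<Theta> (u i))) = err_coords \<Theta> ` span (range u)"
    using linear_span_image[OF linear_err_coords, of \<Theta> "range u"] by (simp add: image_image)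
  then show "det (\<chi> i. err_coords \<Theta> (u i)) \<noteq> 0"
    using assms(2) surj_err_coords by (intro det_nonzero_if_span_rows) simp
qed

lemma integral_basis_reduction_bound:
  fixes u p :: "'n::finite option \<Rightarrow> real \<times> (real^'n)" and rank :: "'n option \<Rightarrow> nat"
  assumes integral: "\<And>i. integral_vec (u i)" and span: "span (range u) = UNIV"
    and lower: "\<And>i. p i \<in> span (u ` {j. rank j < rank i})"
  shows "1 \<le> fact CARD('n option) * (\<Prod>i\<in>UNIV. infnorm (err_coords \<Theta> (u i - p i)))"
proof -
  have "err_coords \<Theta> (p i) \<in> span ((\<lambda>i. err_coords \<Theta> (u i)) ` {j. rank j < rank i})" for i
    using imageI[OF lower[of i], of "err_coords \<Theta>"]
    by (simp add: image_image flip: linear_span_image[OF linear_err_coords])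
  then have "det (\<chi> i. err_coords \<Theta> (u i)) = det (\<chi> i. err_coords \<Theta> (u i) - err_coords \<Theta> (p i))"
    by (rule det_diff_lower_rank_rows[symmetric])
  also have "\<dots> = det (\<chi> i. err_coords \<Theta> (u i - p i))"
    by (simp add: linear_diff[OF linear_err_coords])
  finally have "1 \<le> \<bar>det (\<chi> i. err_coords \<Theta> (u i - p i))\<bar>"
    using abs_det_err_coords_ge_1[OF integral span, of \<Theta>] by simp
  also have "\<dots> \<le> fact CARD('n option) * (\<Prod>i\<in>UNIV. infnorm (err_coords \<Theta> (u i - p i)))"
    by (rule abs_det_le_prod_row_bounds) (simp add: component_le_infnorm_cart)
  finally show ?thesis .
qed

lemma UNIV_4_option: "(UNIV :: 4 option set) = {None, Some 1, Some 2, Some 3, Some 4}"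
  unfolding UNIV_option_conv UNIV_4 by simp

section \<open>Admissible tuples\<close>

context independent_point
begin

definition rescaled :: "nat \<Rightarrow> nat \<Rightarrow> real \<times> (real^4)" where
  "rescaled i j = (real (X i) / real (X j)) *\<^sub>R z j"

lemma infnorm_diff_rescaled_le:
  "infnorm (err_coords \<Theta> (z i - rescaled i j)) \<le> L i + real (X i) / real (X j) * L j"
proof (rule infnorm_err_coords_le)
  show "\<bar>fst (z i - rescaled i j)\<bar> \<le> L i + real (X i) / real (X j) * L j"
    using X_pos[of j] by (simp add: rescaled_def fst_best_z approx_err_nonneg)
  show "infnorm (err_vec \<Theta> (z i - rescaled i j)) \<le> L i + real (X i) / real (X j) * L j"
    using infnorm_triangle[of "err_vec \<Theta> (z i)" "- err_vec \<Theta> (rescaled i j)"]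
    by (simp add: rescaled_def err_vec_diff err_vec_scaleR infnorm_neg infnorm_mul
        infnorm_err_vec_best_z)
qed

lemma infnorm_diff_rescaled_le_before:
  assumes "i < j"
  shows "infnorm (err_coords \<Theta> (z i - rescaled i j)) \<le> 2 * L i"
proof -
  have "real (X i) / real (X j) * L j \<le> 1 * L i"
    using X_less[OF assms] L_less[OF assms] X_pos[of j]
    by (intro mult_mono) (auto simp: approx_err_nonneg)
  then show ?thesis
    using infnorm_diff_rescaled_le[of i j] by linarith
qed

lemma infnorm_diff_rescaled_le_after:
  assumes "j < i"
  shows "infnorm (err_coords \<Theta> (z i - rescaled i j)) \<le> 2 * (real (X i) * L j / real (X j))"
proof -
  define t where "t = real (X i) / real (X j) * L j"
  have "1 * L i \<le> t"
    unfolding t_def using X_less[OF assms] L_less[OF assms] X_pos[of j]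
    by (intro mult_mono) (auto simp: approx_err_nonneg)
  then have "infnorm (err_coords \<Theta> (z i - rescaled i j)) \<le> 2 * t"
    using infnorm_diff_rescaled_le[of i j, folded t_def] by linarith
  then show ?thesis
    by (simp add: t_def)
qed

lemma infnorm_err_coords_best_z_le: "infnorm (err_coords \<Theta> (z m)) \<le> real (X m)"
proof (rule infnorm_err_coords_le)
  show "infnorm (err_vec \<Theta> (z m)) \<le> real (X m)"
    using approx_err_le_half[of \<Theta> "X m"] X_pos[of m] by (simp add: infnorm_err_vec_best_z)
qed (simp add: fst_best_z)

end

locale admissible_indices = independent_point +
  fixes n :: nat and r :: "nat \<Rightarrow> nat"
  assumes n_ge_1: "1 \<le> n" and admissible: "admissible_tuple \<Theta> n r"
begin

abbreviation \<nu> :: nat where "\<nu> \<equiv> r 0"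
abbreviation s :: nat where "s \<equiv> r 1"
abbreviation k :: nat where "k \<equiv> r (n + 1)"
abbreviation T :: "(real \<times> (real^4)) set" where "T \<equiv> span {z (s - 1), z s, z (s + 1)}"

lemma \<nu>_ge_1: "1 \<le> \<nu>"
  using admissible unfolding admissible_tuple_def Let_def by blast

lemma r_less:
  assumes "i < j" "j \<le> n + 1"
  shows "r i < r j"
  using assms
proof (induction j)
  case (Suc j)
  have "r j < r (j + 1)"
    using admissible Suc.prems unfolding admissible_tuple_def Let_def by simp
  then show ?case
    using Suc by (cases "i = j") auto
qed simp

lemma \<nu>_less_s: "\<nu> < s"
  by (rule r_less) simp_all

lemma s_less_k: "s < k"
  using n_ge_1 by (intro r_less) simp_all

lemma span_plane_eq:
  assumes "i \<le> n"
  shows "span {z (r i), z (r i + 1)} = span {z (r (i + 1) - 1), z (r (i + 1))}"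
proof -
  have "\<exists>S. subspace S \<and> dim S = 2 \<and>
      (\<forall>m. r i \<le> m \<and> m \<le> r (i + 1) - 1 \<longrightarrow> span {z m, z (m + 1)} = S)"
    using admissible assms unfolding admissible_tuple_def Let_def by blast
  then obtain S
    where S: "\<And>m. r i \<le> m \<and> m \<le> r (i + 1) - 1 \<Longrightarrow> span {z m, z (m + 1)} = S"
    by blast
  have "r i < r (i + 1)"
    using assms by (intro r_less) simp_all
  then show ?thesis
    using S[of "r i"] S[of "r (i + 1) - 1"] by simp
qed

lemma span_around_eq_T:
  assumes "1 \<le> i" "i \<le> n"
  shows "span {z (r i - 1), z (r i), z (r i + 1)} = T"
proof -
  have "\<exists>V. subspace V \<and> dim V = 3 \<and>
      (\<forall>i. 1 \<le> i \<and> i \<le> n \<longrightarrow> V = span {z (r i - 1), z (r i), z (r i + 1)}) \<and>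
      z (r 0 - 1) \<notin> V \<and> z (r (n + 1) + 1) \<notin> V"
    using admissible unfolding admissible_tuple_def Let_def by (elim conjE)
  then obtain V
    where "\<forall>i. 1 \<le> i \<and> i \<le> n \<longrightarrow> V = span {z (r i - 1), z (r i), z (r i + 1)}"
    by (elim exE conjE)
  then show ?thesis
    using assms n_ge_1 by (metis order_refl)
qed

lemma z_\<nu>_in_plane: "z \<nu> \<in> span {z (s - 1), z s}" "z (\<nu> + 1) \<in> span {z (s - 1), z s}"
proof -
  have "span {z \<nu>, z (\<nu> + 1)} = span {z (s - 1), z s}"
    using span_plane_eq[of 0] by simp
  then show "z \<nu> \<in> span {z (s - 1), z s}" "z (\<nu> + 1) \<in> span {z (s - 1), z s}"
    by (metis insertCI span_base)+
qed

lemma z_\<nu>_in_T: "z \<nu> \<in> T"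
  by (rule subsetD[OF span_mono z_\<nu>_in_plane(1)]) simp

lemma z_k_in_T: "z (k - 1) \<in> T" "z k \<in> T"
proof -
  have "span {z (k - 1), z k} = span {z (r n), z (r n + 1)}"
    by (rule span_plane_eq[symmetric]) simp
  also have "\<dots> \<subseteq> span {z (r n - 1), z (r n), z (r n + 1)}"
    by (rule span_mono) auto
  also have "\<dots> = T"
    by (rule span_around_eq_T) (use n_ge_1 in simp_all)
  finally show "z (k - 1) \<in> T" "z k \<in> T"
    using span_base[of _ "{z (k - 1), z k}"] by blast+
qed

lemma span_eq_UNIV: "span {z (\<nu> - 1), z (s - 1), z s, z (s + 1), z (k + 1)} = UNIV"
  (is "span ?U = _")
proof -
  define V where "V = {z (\<nu> - 1), z (r n - 1), z (k - 1), z k, z (k + 1)}"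
  have "lin_indep_tuple [z (\<nu> - 1), z (r n - 1), z (k - 1), z k, z (k + 1)]"
    using admissible unfolding admissible_tuple_def Let_def by blast
  then have V: "independent V" "card V = 5"
    by (simp_all add: lin_indep_tuple_def V_def)
  have "z (r n - 1) \<in> T"
    by (subst span_around_eq_T[OF n_ge_1 order_refl, symmetric]) (simp add: span_base)
  moreover have "T \<subseteq> span ?U"
    by (rule span_mono) auto
  ultimately have "V \<subseteq> span ?U"
    using z_k_in_T by (auto simp: V_def intro: span_base)
  moreover have "UNIV \<subseteq> span V"
    using V by (intro card_ge_dim_independent) simp_all
  ultimately show ?thesis
    using span_minimal[of V "span ?U"] by auto
qed

lemma covolume_bound: "real (X s) * L (s - 1) \<le> 4 * (real (X (\<nu> + 1)) * L \<nu>)"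
  using covolume_le_if_in_span[of \<nu> "s - 1"] z_\<nu>_in_plane \<nu>_less_s by simp

definition basis_index :: "4 option \<Rightarrow> nat" where
  "basis_index = case_option (s + 1)
    (\<lambda>j. if j = 1 then s - 1 else if j = 2 then s else if j = 3 then \<nu> - 1 else k + 1)"

text \<open>Apart from the one with index \<open>None\<close>, each basis vector is reduced by a vector with the same
  denominator.\<close>

definition basis_reduction :: "4 option \<Rightarrow> real \<times> (real^4)" where
  "basis_reduction = case_option 0
    (\<lambda>j. if j = 1 then rescaled (s - 1) (s + 1) else if j = 2 then rescaled s (s + 1)
      else if j = 3 then rescaled (\<nu> - 1) \<nu> else rescaled (k + 1) k)"

definition basis_rank :: "4 option \<Rightarrow> nat" where
  "basis_rank = case_option 0 (\<lambda>j. if j = 1 \<or> j = 2 then 1 else 2)"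

lemma span_basis_eq_UNIV: "span (range (\<lambda>i. z (basis_index i))) = UNIV"
proof -
  have "range (\<lambda>i. z (basis_index i)) = {z (s + 1), z (s - 1), z s, z (\<nu> - 1), z (k + 1)}"
    by (simp add: UNIV_4_option basis_index_def)
  also have "\<dots> = {z (\<nu> - 1), z (s - 1), z s, z (s + 1), z (k + 1)}"
    by (simp only: insert_commute)
  finally show ?thesis
    by (simp only: span_eq_UNIV)
qed

lemma basis_reduction_in_span:
  "basis_reduction i \<in> span ((\<lambda>j. z (basis_index j)) ` {j. basis_rank j < basis_rank i})"
proof -
  let ?B = "\<lambda>m. (\<lambda>j. z (basis_index j)) ` {j. basis_rank j < m}"
  have "basis_index None = s + 1" "basis_rank None < 1"
    by (simp_all add: basis_index_def basis_rank_def)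
  then have rank_1: "z (s + 1) \<in> span (?B 1)"
    by (metis (mono_tags, lifting) imageI mem_Collect_eq span_base)
  have "T = span ((\<lambda>j. z (basis_index j)) ` {None, Some 1, Some 2})"
    by (simp add: basis_index_def insert_commute)
  also have "\<dots> \<subseteq> span (?B 2)"
    by (intro span_mono image_mono) (auto simp: basis_rank_def)
  finally have rank_2: "z \<nu> \<in> span (?B 2)" "z k \<in> span (?B 2)"
    using z_\<nu>_in_T z_k_in_T(2) by blast+
  show ?thesis
  proof (cases i)
    case None
    then show ?thesis by (simp add: basis_reduction_def span_zero)
  next
    case (Some j)
    consider "j = 1" | "j = 2" | "j = 3" | "j = 4"
      using exhaust_4[of j] by blast
    then show ?thesis
      by cases (use rank_1 rank_2 in
        \<open>simp_all add: Some basis_reduction_def basis_rank_def rescaled_def span_scale\<close>)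
  qed
qed

lemma determinant_bound:
  "1 \<le> 1920 * (real (X (s + 1)) * (L (s - 1) * L s * L (\<nu> - 1) *
    (real (X (k + 1)) * L k / real (X k))))"
proof -
  let ?e = "\<lambda>i. infnorm (err_coords \<Theta> (z (basis_index i) - basis_reduction i))"
  note defs = basis_index_def basis_reduction_def
  have "1 \<le> fact CARD(4 option) * (\<Prod>i\<in>UNIV. ?e i)"
    by (rule integral_basis_reduction_bound[OF integral_vec_best_z span_basis_eq_UNIV
          basis_reduction_in_span])
  also have "\<dots> = 120 * (?e None * (?e (Some 1) * ?e (Some 2) * ?e (Some 3) * ?e (Some 4)))"
    by (simp add: UNIV_4_option fact_numeral mult.assoc)
  also have "\<dots> \<le> 120 * (real (X (s + 1)) *
      ((2 * L (s - 1)) * (2 * L s) * (2 * L (\<nu> - 1)) *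
        (2 * (real (X (k + 1)) * L k / real (X k)))))"
  proof (intro mult_left_mono mult_mono mult_nonneg_nonneg infnorm_pos_le)
    show "?e None \<le> real (X (s + 1))"
      using infnorm_err_coords_best_z_le[of "s + 1"] by (simp add: defs)
    show "?e (Some 1) \<le> 2 * L (s - 1)"
      using infnorm_diff_rescaled_le_before[of "s - 1" "s + 1"] by (simp add: defs)
    show "?e (Some 2) \<le> 2 * L s"
      using infnorm_diff_rescaled_le_before[of s "s + 1"] by (simp add: defs)
    show "?e (Some 3) \<le> 2 * L (\<nu> - 1)"
      using infnorm_diff_rescaled_le_before[of "\<nu> - 1" \<nu>] \<nu>_ge_1 by (simp add: defs)
    show "?e (Some 4) \<le> 2 * (real (X (k + 1)) * L k / real (X k))"
      using infnorm_diff_rescaled_le_after[of k "k + 1"] by (simp add: defs)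
  qed (auto simp: approx_err_nonneg)
  finally show ?thesis
    by simp
qed

end

section \<open>Exponents\<close>

lemma finite_denoms_le: "finite {q::nat. 0 < q \<and> real q \<le> t}"
proof (rule finite_subset)
  show "{q::nat. 0 < q \<and> real q \<le> t} \<subseteq> {..nat \<lfloor>t\<rfloor>}"
    by (auto simp: le_nat_floor)
qed simp

lemma psi_le_approx_err: "0 < q \<Longrightarrow> real q \<le> t \<Longrightarrow> psi \<Theta> t \<le> approx_err \<Theta> q"
  unfolding psi_def using finite_denoms_le by (intro Min_le) auto

lemma psi_attained:
  assumes "1 \<le> t"
  obtains q where "0 < q" "real q \<le> t" "psi \<Theta> t = approx_err \<Theta> q"
proof -
  have "psi \<Theta> t \<in> approx_err \<Theta> ` {q. 0 < q \<and> real q \<le> t}"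
    unfolding psi_def using finite_denoms_le assms by (intro Min_in) (auto intro!: exI[of _ 1])
  then show ?thesis
    using that by auto
qed

lemma powr_quarter_psi_le:
  assumes "1 \<le> t"
  shows "t powr (1/4) * psi \<Theta> t \<le> 2"
proof -
  define N where "N = nat \<lfloor>t powr (1/4)\<rfloor>"
  have "1 \<le> t powr (1/4)"
    using assms by (simp add: ge_one_powr_ge_zero)
  then have N: "0 < N" "real N \<le> t powr (1/4)" "t powr (1/4) \<le> real N + 1"
    unfolding N_def by linarith+
  obtain q where q: "0 < q" "q \<le> N^4" "approx_err \<Theta> q \<le> 1 / real N"
    using Dirichlet_approx_err[OF N(1)] by metis
  have "real q \<le> real N ^ 4"
    using q(2) by (metis of_nat_le_iff of_nat_power)
  also have "\<dots> \<le> (t powr (1/4)) ^ 4"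
    using N by (intro power_mono) auto
  also have "\<dots> = t"
    using assms by (simp add: powr_power)
  finally have "psi \<Theta> t \<le> 1 / real N"
    using psi_le_approx_err[of q t \<Theta>] q by linarith
  then have "t powr (1/4) * psi \<Theta> t \<le> t powr (1/4) * (1 / real N)"
    by (intro mult_left_mono) auto
  also have "\<dots> \<le> 2 * real N * (1 / real N)"
    using N(1,3) by (intro mult_right_mono) auto
  also have "\<dots> = 2"
    using N by simp
  finally show ?thesis .
qed

lemma omega_hat_ge: "ereal (1/4) \<le> omega_hat \<Theta>"
proof -
  have "\<forall>\<^sub>F t in at_top. ereal (t powr (1/4) * psi \<Theta> t) \<le> ereal 2"
    using eventually_ge_at_top[of 1] by eventually_elim (simp add: powr_quarter_psi_le)
  then have "Limsup at_top (\<lambda>t::real. ereal (t powr (1/4) * psi \<Theta> t)) \<le> ereal 2"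
    by (rule Limsup_bounded)
  then have "Limsup at_top (\<lambda>t::real. ereal (t powr (1/4) * psi \<Theta> t)) < \<infinity>"
    using le_less_trans by fastforce
  then show ?thesis
    unfolding omega_hat_def by (intro Sup_upper) auto
qed

lemma eventually_powr_psi_le_if_less_omega_hat:
  assumes "ereal w < omega_hat \<Theta>"
  obtains K where "\<forall>\<^sub>F t in at_top. t powr w * psi \<Theta> t \<le> K"
proof -
  obtain \<gamma> where \<gamma>: "w < \<gamma>" "Limsup at_top (\<lambda>t::real. ereal (t powr \<gamma> * psi \<Theta> t)) < \<infinity>"
    using assms unfolding omega_hat_def less_Sup_iff by auto
  obtain K where "Limsup at_top (\<lambda>t::real. ereal (t powr \<gamma> * psi \<Theta> t)) < ereal K"
    using ereal_dense2[OF \<gamma>(2)] by blast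
  then have "\<forall>\<^sub>F t in at_top. ereal (t powr \<gamma> * psi \<Theta> t) < ereal K"
    by (rule Limsup_lessD)
  then have "\<forall>\<^sub>F t in at_top. t powr w * psi \<Theta> t \<le> K"
    using eventually_ge_at_top[of 1]
  proof eventually_elim
    case (elim t)
    have "0 \<le> psi \<Theta> t"
      using psi_attained[OF elim(2)] approx_err_nonneg by metis
    then have "t powr w * psi \<Theta> t \<le> t powr \<gamma> * psi \<Theta> t"
      using \<gamma>(1) elim(2) by (intro mult_right_mono powr_mono) auto
    then show ?case
      using elim(1) by simp
  qed
  then show ?thesis
    by (rule that)
qed

lemma eventually_powr_psi_gt_if_omega_less:
  assumes "omega \<Theta> < ereal \<gamma>"
  shows "\<forall>\<^sub>F t in at_top. b < t powr \<gamma> * psi \<Theta> t"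
proof -
  have "Liminf at_top (\<lambda>t::real. ereal (t powr \<gamma> * psi \<Theta> t)) = \<infinity>"
  proof (rule ccontr)
    assume "\<not> ?thesis"
    then have "ereal \<gamma> \<le> omega \<Theta>"
      unfolding omega_def by (intro Sup_upper) auto
    then show False
      using assms by simp
  qed
  then have "ereal b < Liminf at_top (\<lambda>t::real. ereal (t powr \<gamma> * psi \<Theta> t))"
    by simp
  then show ?thesis
    using less_LiminfD by fastforce
qed

context independent_point
begin

lemma L_le_psi:
  assumes "1 \<le> t" "t < real (X (Suc m))"
  shows "L m \<le> psi \<Theta> t"
proof -
  obtain q where "0 < q" "real q \<le> t" "psi \<Theta> t = approx_err \<Theta> q"
    using psi_attained[OF assms(1)] by metis
  then show ?thesis
    using L_le_approx_err[of q m] assms(2) by simp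
qed

lemma psi_le_L: "psi \<Theta> (real (X m)) \<le> L m"
  by (intro psi_le_approx_err X_pos) simp

lemma filterlim_X: "filterlim (\<lambda>m. real (X m)) at_top sequentially"
  by (rule filterlim_at_top_mono[OF filterlim_real_sequentially]) (simp add: X_ge)

abbreviation log_X :: "nat \<Rightarrow> real" where "log_X m \<equiv> ln (real (X m))"
abbreviation log_inv_L :: "nat \<Rightarrow> real" where "log_inv_L m \<equiv> - ln (L m)"

lemma log_X_nonneg: "0 \<le> log_X m"
  using X_pos[of m] by simp

lemma log_X_mono: "m \<le> n \<Longrightarrow> log_X m \<le> log_X n"
  using X_le[of m n] X_pos[of m] by simp

lemma filterlim_log_X: "filterlim log_X at_top sequentially"
  by (rule filterlim_compose[OF ln_at_top filterlim_X])

lemma eventually_log_inv_L_ge: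
  assumes "ereal w < omega_hat \<Theta>"
  obtains C where "\<forall>\<^sub>F m in sequentially. w * log_X (Suc m) - C \<le> log_inv_L m"
proof -
  obtain K where K: "\<forall>\<^sub>F t in at_top. t powr w * psi \<Theta> t \<le> K"
    using eventually_powr_psi_le_if_less_omega_hat[OF assms] .
  have "filterlim (\<lambda>m. 1/2 * real (X (Suc m))) at_top sequentially"
    by (intro filterlim_tendsto_pos_mult_at_top[OF tendsto_const]
        filterlim_compose[OF filterlim_X filterlim_Suc]) simp
  then have "\<forall>\<^sub>F m in sequentially.
      (1/2 * real (X (Suc m))) powr w * psi \<Theta> (1/2 * real (X (Suc m))) \<le> K"
    by (rule eventually_compose_filterlim[OF K])
  moreover have "\<forall>\<^sub>F m in sequentially. 1 \<le> m"
    by (rule eventually_ge_at_top)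
  ultimately have "\<forall>\<^sub>F m in sequentially. w * log_X (Suc m) - (w * ln 2 + ln K) \<le> log_inv_L m"
  proof eventually_elim
    case (elim m)
    define t where "t = 1/2 * real (X (Suc m))"
    have t: "1 \<le> t" "t < real (X (Suc m))"
      using X_ge[of "Suc m"] elim(2) by (simp_all add: t_def)
    have "t powr w * L m \<le> t powr w * psi \<Theta> t"
      using L_le_psi[OF t] by (intro mult_left_mono) auto
    then have "t powr w * L m \<le> K"
      using elim(1) by (simp add: t_def)
    then have "ln (t powr w * L m) \<le> ln K"
      using t L_pos[of m] by (intro ln_mono) auto
    moreover have "ln (t powr w * L m) = w * (log_X (Suc m) - ln 2) + ln (L m)"
      using t L_pos[of m] X_pos[of "Suc m"] by (simp add: ln_mult ln_powr t_def ln_div)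
    ultimately show ?case
      by (simp add: algebra_simps)
  qed
  then show ?thesis
    by (rule that)
qed

lemma eventually_log_inv_L_le:
  assumes "omega \<Theta> < ereal \<gamma>"
  shows "\<forall>\<^sub>F m in sequentially. log_inv_L m \<le> \<gamma> * log_X m"
  using eventually_compose_filterlim[OF
      eventually_powr_psi_gt_if_omega_less[OF assms, of 1] filterlim_X]
proof eventually_elim
  case (elim m)
  have "1 < real (X m) powr \<gamma> * L m"
    using elim mult_left_mono[OF psi_le_L[of m], of "real (X m) powr \<gamma>"] by simp
  then have "0 < ln (real (X m) powr \<gamma> * L m)"
    by simp
  also have "\<dots> = \<gamma> * log_X m + ln (L m)"
    using L_pos[of m] X_pos[of m] by (simp add: ln_mult ln_powr)
  finally show ?case
    by simp
qed

end

lemma le_convex_combination: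
  fixes a b c t :: "'a::linordered_idom"
  assumes "a \<le> b" "a \<le> c" "0 \<le> t" "t \<le> 1"
  shows "a \<le> (1 - t) * b + t * c"
  using convex_bound_le[of "- b" "- a" "- c" "1 - t" t] assms by simp

lemma
  fixes w g :: real
  assumes "0 < w" "0 < g" "(1 - w) * g^3 = w * (g^2 + g + 1)"
  shows cubic_eq_imp_mult_Suc_le: "w * (g + 1) \<le> (1 - w) * g^2"
    and cubic_eq_imp_le: "w \<le> (1 - w) * g"
proof -
  have "w * (g + 1) * g \<le> (1 - w) * g^2 * g"
    using assms by (simp add: power3_eq_cube power2_eq_square algebra_simps)
  then show "w * (g + 1) \<le> (1 - w) * g^2"
    using assms(2) by (rule mult_right_le_imp_le)
  then have "w * g \<le> (1 - w) * g * g"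
    using assms(1) by (simp add: power2_eq_square algebra_simps)
  then show "w \<le> (1 - w) * g"
    using assms(2) by (rule mult_right_le_imp_le)
qed

lemma exponent_elimination:
  fixes w g K a0 a1 y0 y1 y2 :: real
  assumes w: "0 < w" "w < 1" and g: "0 < g" "(1 - w) * g^3 = w * (g^2 + g + 1)"
    and a0: "a0 \<le> (1 - w) * y1 + K" "a0 \<le> (1 - w) * g * y0 + K"
    and a1: "a1 \<le> (1 - w) * y2 + K" "a1 \<le> (1 - w) * g * y1 + K"
  shows "a0 + a1 - y1 - w * y0 \<le> 2 * K + (1 - (1 - w) * g) * y2"
proof -
  txt \<open>The weights \<open>\<alpha>\<close> and \<open>\<beta>\<close> of the convex combinations cancel \<open>y0\<close> and \<open>y1\<close>, respectively.\<close>
  define \<alpha> where "\<alpha> = w / ((1 - w) * g)"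
  define \<beta> where "\<beta> = w * (g + 1) / ((1 - w) * g^2)"
  have \<alpha>: "0 \<le> \<alpha>" "\<alpha> \<le> 1"
    using w g(1) cubic_eq_imp_le[OF w(1) g] by (simp_all add: \<alpha>_def)
  have \<beta>: "0 \<le> \<beta>" "\<beta> \<le> 1"
    using w g(1) cubic_eq_imp_mult_Suc_le[OF w(1) g] by (simp_all add: \<beta>_def)
  have "a0 \<le> (1 - \<alpha>) * ((1 - w) * y1 + K) + \<alpha> * ((1 - w) * g * y0 + K)"
    using a0 \<alpha> by (rule le_convex_combination)
  also have "\<dots> = (1 - w - w / g) * y1 + w * y0 + K"
  proof -
    have "\<alpha> * (1 - w) = w / g" "\<alpha> * ((1 - w) * g) = w"
      using w g(1) by (simp_all add: \<alpha>_def)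
    then show ?thesis by algebra
  qed
  finally have a0_le: "a0 \<le> (1 - w - w / g) * y1 + w * y0 + K" .
  have "a1 \<le> (1 - \<beta>) * ((1 - w) * y2 + K) + \<beta> * ((1 - w) * g * y1 + K)"
    using a1 \<beta> by (rule le_convex_combination)
  also have "\<dots> = (1 - (1 - w) * g) * y2 + (w + w / g) * y1 + K"
  proof -
    have "\<beta> * ((1 - w) * g) = w + w / g"
      using w g(1) by (simp add: \<beta>_def field_simps power2_eq_square)
    moreover have "\<beta> * (1 - w) * g^2 = w * (g + 1)"
      using w g(1) by (simp add: \<beta>_def)
    then have "\<beta> * (1 - w) * g^2 = ((1 - w) * g - w) * g^2"
      using g(2) by algebra
    then have "\<beta> * (1 - w) = (1 - w) * g - w"
      using g(1) by simp
    ultimately show ?thesis by algebra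
  qed
  finally show ?thesis
    using a0_le by (simp add: algebra_simps)
qed

context independent_point
begin

definition log_covolume :: "nat \<Rightarrow> real" where
  "log_covolume m = log_X (Suc m) - log_inv_L m"

lemma log_covolume_eq_ln: "log_covolume m = ln (real (X (Suc m)) * L m)"
  using X_pos[of "Suc m"] L_pos[of m] by (simp add: log_covolume_def ln_mult)

lemma log_covolume_le:
  assumes "0 < w" "w < 1" "0 \<le> D" "w * (log_X (Suc m) - D) \<le> log_inv_L m"
  shows "log_covolume m \<le> (1 - w) * log_X (Suc m) + D"
    and "log_X (Suc m) \<le> G * log_X m + D \<Longrightarrow> G \<le> g \<Longrightarrow> log_covolume m \<le> (1 - w) * g * log_X m + D"
proof -
  have le: "log_covolume m \<le> (1 - w) * log_X (Suc m) + w * D"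
    using assms(4) by (simp add: log_covolume_def algebra_simps)
  also have "w * D \<le> D"
    using assms by (simp add: mult_left_le_one_le)
  finally show "log_covolume m \<le> (1 - w) * log_X (Suc m) + D"
    by simp
  assume "log_X (Suc m) \<le> G * log_X m + D" "G \<le> g"
  then have "log_X (Suc m) \<le> g * log_X m + D"
    using mult_right_mono[OF \<open>G \<le> g\<close> log_X_nonneg[of m]] by linarith
  then have "(1 - w) * log_X (Suc m) \<le> (1 - w) * (g * log_X m + D)"
    using assms(2) by (intro mult_left_mono) auto
  with le show "log_covolume m \<le> (1 - w) * g * log_X m + D"
    by (simp add: algebra_simps)
qed

end

context admissible_indices
begin

lemma log_covolume_bound: "log_covolume (s - 1) \<le> ln 4 + log_covolume \<nu>"
proof -
  have "ln (real (X s) * L (s - 1)) \<le> ln (4 * (real (X (\<nu> + 1)) * L \<nu>))"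
    using covolume_bound by (intro ln_mono) (auto intro!: mult_pos_pos X_pos L_pos)
  moreover have "Suc (s - 1) = s"
    using \<nu>_less_s by simp
  ultimately show ?thesis
    using X_pos[of "\<nu> + 1"] L_pos[of \<nu>] by (simp add: log_covolume_eq_ln ln_mult)
qed

lemma log_determinant_bound:
  "0 \<le> ln 1920 + (log_covolume (s - 1) - log_X s) + log_covolume s - log_inv_L (\<nu> - 1)
    + (log_covolume k - log_X k)"
proof -
  have "ln 1 \<le> ln (1920 * (real (X (s + 1)) * (L (s - 1) * L s * L (\<nu> - 1) *
      (real (X (k + 1)) * L k / real (X k)))))"
    using determinant_bound by (intro ln_mono) auto
  moreover have "Suc (s - 1) = s"
    using \<nu>_less_s by simp
  moreover have "0 < real (X m)" for m
    using X_pos by simp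
  ultimately show ?thesis
    using L_pos by (simp add: log_covolume_def ln_mult ln_div less_imp_neq[symmetric])
qed

lemma log_X_k_bound:
  assumes w: "0 < w" "w < 1" and g: "0 < g" "(1 - w) * g^3 = w * (g^2 + g + 1)"
    and "G \<le> g" "0 \<le> D" "M < \<nu>"
    and lower: "\<And>m. M \<le> m \<Longrightarrow> w * (log_X (Suc m) - D) \<le> log_inv_L m"
    and growth: "\<And>m. M \<le> m \<Longrightarrow> log_X (Suc m) \<le> G * log_X m + D"
  shows "(1 - w) * (g - G) * log_X k \<le> ln 1920 + 2 * (ln 4 + D) + 2 * D"
proof -
  note covolume_le = log_covolume_le[OF w \<open>0 \<le> D\<close> lower]
  have M_le: "M \<le> \<nu> - 1" "M \<le> \<nu>" "M \<le> s - 1" "M \<le> s" "M \<le> k"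
    using \<open>M < \<nu>\<close> \<nu>_less_s s_less_k by simp_all
  note covolume_le_g = covolume_le(2)[OF _ growth \<open>G \<le> g\<close>]
  have ln_4: "0 \<le> ln (4 :: real)"
    by simp
  have Suc_s: "Suc (s - 1) = s"
    using \<nu>_less_s by simp
  have s_bounds: "log_covolume (s - 1) \<le> (1 - w) * log_X s + (ln 4 + D)"
    "log_covolume (s - 1) \<le> (1 - w) * g * log_X \<nu> + (ln 4 + D)"
    using covolume_le(1)[OF M_le(3)] covolume_le_g[OF M_le(2,2)] log_covolume_bound ln_4
    unfolding Suc_s by linarith+
  have "log_covolume s \<le> (1 - w) * log_X (Suc s) + D"
    by (rule covolume_le(1)[OF M_le(4)])
  also have "(1 - w) * log_X (Suc s) \<le> (1 - w) * log_X k"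
    using s_less_k w by (intro mult_left_mono log_X_mono) auto
  finally have k_bounds: "log_covolume s \<le> (1 - w) * log_X k + (ln 4 + D)"
    "log_covolume s \<le> (1 - w) * g * log_X s + (ln 4 + D)"
    using covolume_le_g[OF M_le(4,4)] ln_4 by linarith+
  have "log_covolume (s - 1) + log_covolume s - log_X s - w * log_X \<nu>
      \<le> 2 * (ln 4 + D) + (1 - (1 - w) * g) * log_X k"
    by (rule exponent_elimination[OF w g s_bounds k_bounds])
  moreover have "w * (log_X \<nu> - D) \<le> log_inv_L (\<nu> - 1)"
    using lower[OF M_le(1)] \<nu>_ge_1 by simp
  moreover have "w * D \<le> D"
    using w \<open>0 \<le> D\<close> by (simp add: mult_left_le_one_le)
  moreover have "log_covolume k \<le> (1 - w) * G * log_X k + D"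
    by (rule covolume_le(2)[OF M_le(5) growth[OF M_le(5)] order_refl])
  ultimately show ?thesis
    using log_determinant_bound by (simp add: algebra_simps)
qed

end

context independent_point
begin

lemma eventually_log_bounds:
  assumes "0 < w" "ereal w < omega_hat \<Theta>" "omega \<Theta> < ereal (w * G)"
  obtains D where "0 \<le> D"
    "\<forall>\<^sub>F m in sequentially.
      w * (log_X (Suc m) - D) \<le> log_inv_L m \<and> log_X (Suc m) \<le> G * log_X m + D"
proof -
  obtain C where C: "\<forall>\<^sub>F m in sequentially. w * log_X (Suc m) - C \<le> log_inv_L m"
    using eventually_log_inv_L_ge[OF assms(2)] .
  define D where "D = max 0 C / w"
  have D: "0 \<le> D" "C \<le> w * D"
    using assms(1) by (simp_all add: D_def)
  have "\<forall>\<^sub>F m in sequentially.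
      w * (log_X (Suc m) - D) \<le> log_inv_L m \<and> log_X (Suc m) \<le> G * log_X m + D"
    using C eventually_log_inv_L_le[OF assms(3)]
  proof eventually_elim
    case (elim m)
    have lower: "w * (log_X (Suc m) - D) \<le> log_inv_L m"
      using elim(1) D(2) by (simp add: algebra_simps)
    with elim(2) have "w * log_X (Suc m) \<le> w * (G * log_X m + D)"
      by (simp add: algebra_simps)
    with lower show ?case
      using assms(1) by simp
  qed
  with D(1) show ?thesis
    by (rule that)
qed

lemma G1_le_growth_exponent:
  assumes "1 \<le> n" and lim: "filterlim (\<lambda>i. r i 0) at_top sequentially"
    and adm: "\<And>i. admissible_tuple \<Theta> n (r i)"
    and w: "0 < w" "w < 1" and "0 \<le> D"
    and ev: "\<forall>\<^sub>F m in sequentially.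
      w * (log_X (Suc m) - D) \<le> log_inv_L m \<and> log_X (Suc m) \<le> G * log_X m + D"
  shows "G1 w \<le> G"
proof (rule ccontr)
  assume "\<not> ?thesis"
  then have "G < G1 w"
    by simp
  then have gap_pos: "0 < (1 - w) * (G1 w - G)"
    using w by simp
  obtain M where M: "w * (log_X (Suc m) - D) \<le> log_inv_L m" "log_X (Suc m) \<le> G * log_X m + D"
    if "M \<le> m" for m
    using ev unfolding eventually_sequentially by blast
  define B where "B = ln 1920 + 2 * (ln 4 + D) + 2 * D"
  have bound: "log_X (r i 0) \<le> B / ((1 - w) * (G1 w - G))" if "M < r i 0" for i
  proof -
    interpret admissible_indices \<Theta> n "r i"
      by standard (fact assms(1) adm)+
    have "(1 - w) * (G1 w - G) * log_X (r i 0) \<le> (1 - w) * (G1 w - G) * log_X (r i (n + 1))"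
      using gap_pos \<nu>_less_s s_less_k by (intro mult_left_mono log_X_mono) auto
    also have "\<dots> \<le> B"
      unfolding B_def using G1_pos[OF w] G1_cubic_eq[OF w] \<open>G < G1 w\<close> \<open>0 \<le> D\<close> that
      by (intro log_X_k_bound[OF w] M) auto
    finally show ?thesis
      using gap_pos by (simp add: pos_le_divide_eq mult.commute)
  qed
  have "filterlim (\<lambda>i. log_X (r i 0)) at_top sequentially"
    by (rule filterlim_compose[OF filterlim_log_X lim])
  then have "\<forall>\<^sub>F i in sequentially. B / ((1 - w) * (G1 w - G)) < log_X (r i 0)"
    by (simp add: filterlim_at_top_dense)
  moreover have "\<forall>\<^sub>F i in sequentially. M < r i 0"
    by (rule eventually_compose_filterlim[OF eventually_gt_at_top lim])
  ultimately have "\<forall>\<^sub>F i in sequentially. False"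
    by eventually_elim (use bound in fastforce)
  then show False
    by simp
qed

lemma omega_ge_mult_G1:
  assumes tuples: "1 \<le> n" "filterlim (\<lambda>i. r i 0) at_top sequentially"
      "\<And>i. admissible_tuple \<Theta> n (r i)"
    and w: "0 < w" "w < 1" "ereal w < omega_hat \<Theta>"
  shows "ereal (w * G1 w) \<le> omega \<Theta>"
proof (rule ccontr)
  assume "\<not> ?thesis"
  then have "omega \<Theta> < ereal (w * G1 w)"
    by simp
  then obtain \<gamma> where \<gamma>: "omega \<Theta> < ereal \<gamma>" "\<gamma> < w * G1 w"
    using ereal_dense2 less_ereal.simps(1) by blast
  define G where "G = \<gamma> / w"
  have G: "G < G1 w" "omega \<Theta> < ereal (w * G)"
    using \<gamma> w(1) by (simp_all add: G_def pos_divide_less_eq mult.commute)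
  obtain D where "0 \<le> D" "\<forall>\<^sub>F m in sequentially.
      w * (log_X (Suc m) - D) \<le> log_inv_L m \<and> log_X (Suc m) \<le> G * log_X m + D"
    using eventually_log_bounds[OF w(1,3) G(2)] .
  then have "G1 w \<le> G"
    by (rule G1_le_growth_exponent[OF tuples w(1,2)])
  then show False
    using G(1) by simp
qed

end

lemma approx_index_eq_enatD:
  assumes "approx_index \<Theta> = enat n"
  obtains r where "1 \<le> n" "filterlim (\<lambda>i. r i 0) at_top sequentially"
    "\<And>i. admissible_tuple \<Theta> n (r i)"
proof -
  let ?S = "{n. 1 \<le> n \<and> (\<exists>r::nat \<Rightarrow> nat \<Rightarrow> nat. filterlim (\<lambda>l. r l 0) at_top sequentially \<and>
    (\<forall>l. admissible_tuple \<Theta> n (r l)))}"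
  have Inf: "Inf (enat ` ?S) = enat n"
    using assms unfolding approx_index_def .
  have "enat ` ?S \<noteq> {}"
  proof
    assume "enat ` ?S = {}"
    then show False
      using Inf by (simp only: Inf_empty top_enat_def enat.distinct)
  qed
  then obtain m where m: "m \<in> ?S" by blast
  have "Inf (enat ` ?S) \<in> enat ` ?S"
    by (rule wellorder_InfI[OF imageI[OF m]])
  then have "n \<in> ?S"
    unfolding Inf by blast
  then show ?thesis
    using that by blast
qed

theorem omega_ge_omega_hat_mult_G1:
  assumes "lin_indep_over_Z \<Theta>" "approx_index \<Theta> = enat n"
    and "omega_hat \<Theta> = ereal W" "W < 1"
  shows "ereal (W * G1 W) \<le> omega \<Theta>"
proof -
  interpret independent_point \<Theta>
    by standard (fact assms(1))
  have "0 < W"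
    using omega_hat_ge[of \<Theta>] assms(3) by simp
  obtain r where r: "1 \<le> n" "filterlim (\<lambda>i. r i 0) at_top sequentially"
    "\<And>i. admissible_tuple \<Theta> n (r i)"
    using approx_index_eq_enatD[OF assms(2)] by metis
  show ?thesis
  proof (rule ereal_le_real)
    fix b
    assume b: "omega \<Theta> \<le> ereal b"
    have "w * G1 w \<le> b" if "0 < w" "w < W" for w
    proof -
      have "w < 1" "ereal w < omega_hat \<Theta>"
        using that assms(3,4) by simp_all
      then have "ereal (w * G1 w) \<le> omega \<Theta>"
        by (rule omega_ge_mult_G1[OF r that(1)])
      also note b
      finally show ?thesis by simp
    qed
    then show "ereal (W * G1 W) \<le> ereal b"
      using mult_G1_le_if_all_less[OF \<open>0 < W\<close> assms(4)] by simp
  qed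
qed

theorem theorem1:
  fixes \<Theta> :: "real^4"
  assumes "lin_indep_over_Z \<Theta>"
    and "omega_hat \<Theta> < 1"
  shows "(approx_index \<Theta> = 1 \<longrightarrow>
            omega \<Theta> \<ge> omega_hat \<Theta> * ereal (G1 (real_of_ereal (omega_hat \<Theta>)))) \<and>
         (approx_index \<Theta> = 2 \<longrightarrow>
            omega \<Theta> \<ge> omega_hat \<Theta> * ereal (G2 (real_of_ereal (omega_hat \<Theta>)))) \<and>
         (approx_index \<Theta> = 3 \<longrightarrow>
            omega \<Theta> \<ge> omega_hat \<Theta> * ereal (G3 (real_of_ereal (omega_hat \<Theta>))))"
proof -
  obtain W where W: "omega_hat \<Theta> = ereal W" "1/4 \<le> W" "W < 1"
    using omega_hat_ge[of \<Theta>] assms(2) by (cases "omega_hat \<Theta>") auto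
  have bound: "ereal (W * a) \<le> omega \<Theta>" if "approx_index \<Theta> = enat n" "a \<le> G1 W" for n a
  proof -
    have "ereal (W * a) \<le> ereal (W * G1 W)"
      using that(2) W(2) by (simp add: mult_left_mono)
    also have "\<dots> \<le> omega \<Theta>"
      by (rule omega_ge_omega_hat_mult_G1[OF assms(1) that(1) W(1,3)])
    finally show ?thesis .
  qed
  show ?thesis
    using bound[of 1 "G1 W"] bound[of 2 "G2 W"] bound[of 3 "G3 W"] G2_le_G1[OF W(2,3)]
      G3_le_G1[OF W(2,3)]
    by (auto simp: W(1) one_enat_def numeral_eq_enat)
qed

end
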